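(* Let $(R,\mathfrak{m},K)$ be a local Artinian commutative ring. Then $R$ is Frobenius if and only if $$\operatorname{type}(C)+\operatorname{fr}(C^\perp)=n$$ for every integer $n\ge 1$ and every $R$-code $C\subseteq R^{n}$.
   Context: All rings are commutative with unity. $(R,\mathfrak{m},K)$ is a local Artinian ring with maximal ideal $\mathfrak{m}$ and residue field $K=R/\mathfrak{m}$ ($R$ need not be finite nor contain a field). An $R$-code of length $n$ is an $R$-submodule $C\subseteq R^n$. The socle of a finitely generated $R$-module $M$ is $\operatorname{soc}(M)=\{v\in M : \mathfrak{m}v=0\}$, and $\operatorname{type}(M)=\dim_K\operatorname{soc}(M)$. $R$ is Frobenius if $\operatorname{soc}(R)\cong K$. The orthogonal code is $C^\perp=\{v\in R^n : v\cdot w=0 \text{ for all } w\in C\}$, where $v\cdot w=v_1w_1+\cdots+v_nw_n$. The free rank $\operatorname{fr}(M)$ of a finitely generated $R$-module $M$ is the maximum rank of a free direct summand of $M$, i.e. $M\cong R^{\operatorname{fr}(M)}\oplus N$ where $N$ has no nonzero free direct summand. *)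

theory Defs
  imports
    "HOL-Algebra.QuotRing"
    "Jordan_Normal_Form.Missing_VectorSpace"
begin

locale local_artinian_ring = cring R for R (structure) +
  fixes \<mm> :: "'a set"
  assumes maximal: "maximalideal \<mm> R"
    and unique_maximal: "maximalideal J R \<Longrightarrow> J = \<mm>"
    and descending_chain:
      "\<lbrakk>\<And>i::nat. ideal (I i) R; \<And>i. I (Suc i) \<subseteq> I i\<rbrakk> \<Longrightarrow> \<exists>N. \<forall>i\<ge>N. I i = I N"

definition module_iso ::
  "('a, 'r) ring_scheme \<Rightarrow> ('a, 'b, 'm) module_scheme \<Rightarrow> ('a, 'c, 'n) module_scheme \<Rightarrow> bool"
  where "module_iso R M N \<longleftrightarrow> (\<exists>f\<in>module_hom R M N. bij_betw f (carrier M) (carrier N))"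

text \<open>The free module of rank \<open>n\<close>: its elements are the functions on \<open>{..<n}\<close> with values in
  \<open>carrier R\<close>, extended by \<open>undefined\<close> outside \<open>{..<n}\<close>.\<close>

abbreviation tuples :: "('a, 'r) ring_scheme \<Rightarrow> nat \<Rightarrow> ('a, nat \<Rightarrow> 'a) module"
  where "tuples R n \<equiv> ring.func_space R {..<n}"

text \<open>The fields \<open>mult\<close> and \<open>one\<close> of a module record carry no meaning; below they are filled with
  whatever is at hand.\<close>

definition regular_module :: "('a, 'r) ring_scheme \<Rightarrow> ('a, 'a) module"
  where "regular_module R =
    \<lparr>carrier = carrier R, mult = mult R, one = one R, zero = zero R, add = add R, smult = mult R\<rparr>"

definition residue_module :: "('a, 'r) ring_scheme \<Rightarrow> 'a set \<Rightarrow> ('a, 'a set) module"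
  where "residue_module R \<mm> =
    \<lparr>carrier = carrier (R Quot \<mm>), mult = mult (R Quot \<mm>), one = one (R Quot \<mm>),
     zero = zero (R Quot \<mm>), add = add (R Quot \<mm>),
     smult = (\<lambda>r X. (\<mm> +>\<^bsub>R\<^esub> r) \<otimes>\<^bsub>R Quot \<mm>\<^esub> X)\<rparr>"

definition socle :: "'a set \<Rightarrow> ('a, 'b, 'm) module_scheme \<Rightarrow> 'b set"
  where "socle \<mm> M = {v \<in> carrier M. \<forall>a\<in>\<mm>. a \<odot>\<^bsub>M\<^esub> v = \<zero>\<^bsub>M\<^esub>}"

text \<open>The socle as a vector space over the residue field \<open>R Quot \<mm>\<close>. A coset \<open>X\<close> of \<open>\<mm>\<close> acts
  through any of its representatives: they all send a socle element to the same element, so the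
  image of \<open>X\<close> below is a singleton.\<close>

definition socle_space :: "'a set \<Rightarrow> ('a, 'b, 'm) module_scheme \<Rightarrow> ('a set, 'b) module"
  where "socle_space \<mm> M =
    \<lparr>carrier = socle \<mm> M, mult = mult M, one = one M, zero = zero M, add = add M,
     smult = (\<lambda>X v. the_elem ((\<lambda>r. r \<odot>\<^bsub>M\<^esub> v) ` X))\<rparr>"

definition module_type :: "('a, 'r) ring_scheme \<Rightarrow> 'a set \<Rightarrow> ('a, 'b, 'm) module_scheme \<Rightarrow> nat"
  where "module_type R \<mm> M = vectorspace.dim (R Quot \<mm>) (socle_space \<mm> M)"

definition frobenius_ring :: "('a, 'r) ring_scheme \<Rightarrow> 'a set \<Rightarrow> bool"
  where "frobenius_ring R \<mm> \<longleftrightarrow>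
    module_iso R ((regular_module R)\<lparr>carrier := socle \<mm> (regular_module R)\<rparr>) (residue_module R \<mm>)"

definition orthogonal :: "('a, 'r) ring_scheme \<Rightarrow> nat \<Rightarrow> (nat \<Rightarrow> 'a) set \<Rightarrow> (nat \<Rightarrow> 'a) set"
  where "orthogonal R n C =
    {v \<in> carrier (tuples R n). \<forall>w\<in>C. (\<Oplus>\<^bsub>R\<^esub>i\<in>{..<n}. v i \<otimes>\<^bsub>R\<^esub> w i) = \<zero>\<^bsub>R\<^esub>}"

definition direct_summand ::
  "('a, 'r) ring_scheme \<Rightarrow> 'b set \<Rightarrow> ('a, 'b, 'm) module_scheme \<Rightarrow> bool"
  where "direct_summand R F M \<longleftrightarrow> submodule R F M \<and>
    (\<exists>N. submodule R N M \<and> F \<inter> N = {\<zero>\<^bsub>M\<^esub>} \<and> module.submodule_sum M F N = carrier M)"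

text \<open>For a finitely generated module over a local Artinian ring the ranks of the free direct
  summands are bounded, so that the maximum exists.\<close>

definition free_rank :: "('a, 'r) ring_scheme \<Rightarrow> ('a, 'b, 'm) module_scheme \<Rightarrow> nat"
  where "free_rank R M =
    Max {k. \<exists>F. direct_summand R F M \<and> module_iso R (tuples R k) (M\<lparr>carrier := F\<rparr>)}"

end

theory Submission
  imports "HOL-Algebra.Ideal_Product" "HOL-Algebra.Ring_Divisibility" Defs
begin

text \<open>
  Everything is measured by lengths of submodules of \<open>R^n\<close>. A local Artinian ring has a finite
  composition series (\<open>ring_composition_series\<close>), hence so has \<open>R^n\<close>
  (\<open>tuples_finite_length\<close>), and the length \<open>len C\<close> of a submodule \<open>C\<close> is
  the number of places at which \<open>C\<close> grows along that fixed series. Two properties suffice to work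
  with it: a submodule of the same length as one that contains it is equal to it
  (\<open>eq_if_len_le\<close>), and enlarging a submodule by one element that \<open>\<mm>\<close> multiplies
  into it raises the length by exactly one (\<open>len_adjoin\<close>). Any two nested submodules are
  linked by finitely many such enlargements, which gives an induction principle
  (\<open>submodule_chain_induct\<close>).

  Let \<open>s \<noteq> 0\<close> be an element of the socle of \<open>R\<close>. Both invariants in the formula are
  lengths: the type of \<open>C\<close> is the length of its socle (\<open>module_type_eq_len\<close>), and the
  free rank of a submodule \<open>D\<close> of \<open>R^n\<close> is the length of \<open>s D\<close>
  (\<open>free_rank_eq_len\<close>). The second fact holds because \<open>s d \<noteq> 0\<close> says that
  \<open>d\<close> has a unit coordinate, so that \<open>d\<close> splits off a free summand of rank one,
  whereas a free submodule of rank \<open>k\<close> contributes \<open>s R^k\<close>, which has length \<open>k\<close>.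

  Let now \<open>R\<close> be Frobenius, so that \<open>s\<close> can be chosen to generate the socle. Enlarging
  \<open>Z\<close> by one element \<open>x\<close> with \<open>\<mm> x \<subseteq> Z\<close> cuts the orthogonal of
  \<open>Z\<close> down by at most one step, because the products \<open>y \<cdot> x\<close> with \<open>y\<close>
  orthogonal to \<open>Z\<close> all lie in \<open>R s\<close> (\<open>orthogonal_step\<close>). Going up from
  \<open>0\<close> to \<open>C\<close> and from \<open>C\<close> to \<open>R^n\<close>, the sum of the lengths of a
  submodule and its orthogonal therefore never drops, and it takes the same value at both ends; this
  gives \<open>len C + len C\<^sup>\<bottom> = len R^n\<close> (\<open>len_orthogonal\<close>) and
  \<open>C\<^sup>\<bottom>\<^sup>\<bottom> = C\<close> (\<open>double_orthogonal\<close>).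

  The formula follows by counting. Put \<open>D = C\<^sup>\<bottom>\<close> and \<open>W = {v. s v \<in> C}\<close>.
  The socle of \<open>C\<close> is \<open>s W\<close>, and multiplication by \<open>s\<close> shows
  \<open>len (s W) = len W - len K\<close>, where \<open>K\<close> is the kernel of \<open>s\<close> on
  \<open>R^n\<close>. But \<open>W\<close> and \<open>K\<close> are the orthogonals of \<open>s D\<close> and of
  \<open>s R^n\<close>, so that the difference is \<open>len (s R^n) - len (s D) = n - len (s D)\<close>
  (\<open>type_plus_free_rank\<close>).

  Conversely, the formula for \<open>n = 1\<close> and \<open>C = R\<close>, whose orthogonal is zero, says that
  the socle of \<open>R\<close> has length one, so that any nonzero element of it generates it
  (\<open>socle_generator_if_type_plus_free_rank\<close>).
\<close>


section \<open>Local Artinian rings\<close>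

lemma (in ring) maximal_ideal_avoiding:
  assumes J: "ideal J R" and x: "x \<notin> J"
  obtains H where "ideal H R" "J \<subseteq> H" "x \<notin> H"
    "\<And>H'. \<lbrakk>ideal H' R; H \<subseteq> H'; x \<notin> H'\<rbrakk> \<Longrightarrow> H' = H"
proof -
  define S where "S = {H. ideal H R \<and> J \<subseteq> H \<and> x \<notin> H}"
  have "\<exists>M\<in>S. \<forall>H\<in>S. M \<subseteq> H \<longrightarrow> H = M"
  proof (rule subset_Zorn)
    fix C assume C: "subset.chain S C"
    show "\<exists>U\<in>S. \<forall>H\<in>C. H \<subseteq> U"
    proof (cases "C = {}")
      case True
      then show ?thesis using J x by (auto simp: S_def)
    next
      case False
      have "subset.chain {I. ideal I R} C"
        using C unfolding pred_on.chain_def S_def by auto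
      from chain_Union_is_ideal[OF this] False have I: "ideal (\<Union>C) R" by simp
      have CS: "C \<subseteq> S" using C unfolding pred_on.chain_def by blast
      obtain H0 where "H0 \<in> C" using False by blast
      then have "J \<subseteq> \<Union>C" using CS unfolding S_def by blast
      moreover have "x \<notin> \<Union>C" using CS unfolding S_def by blast
      ultimately have "\<Union>C \<in> S" using I unfolding S_def by blast
      then show ?thesis by (rule rev_bexI) blast
    qed
  qed
  then obtain M where M: "M \<in> S" "\<And>H. \<lbrakk>H \<in> S; M \<subseteq> H\<rbrakk> \<Longrightarrow> H = M" by blast
  show ?thesis
  proof (rule that)
    show "ideal M R" "J \<subseteq> M" "x \<notin> M" using M(1) by (simp_all add: S_def)
    then show "H' = M" if "ideal H' R" "M \<subseteq> H'" "x \<notin> H'" for H'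
      using that by (intro M(2)) (auto simp: S_def)
  qed
qed

lemma (in cring) ideal_adjoin:
  assumes "ideal K R" and c: "c \<in> carrier R"
  shows "\<exists>L. ideal L R \<and> K \<subseteq> L \<and> c \<in> L \<and>
    (\<forall>y\<in>L. \<exists>k\<in>K. \<exists>r\<in>carrier R. y = k \<oplus> r \<otimes> c)"
proof (intro exI conjI ballI)
  interpret K: ideal K R by fact
  have P: "ideal (PIdl c) R" using c by (rule cgenideal_ideal)
  interpret P: ideal "PIdl c" R by (rule P)
  show "ideal (set_add R K (PIdl c)) R" by (rule add_ideals[OF assms(1) P])
  have z: "\<zero> \<in> PIdl c" by (rule P.zero_closed)
  show "K \<subseteq> set_add R K (PIdl c)"
  proof
    fix k assume k: "k \<in> K"
    then have "k = k \<oplus> \<zero>" by simp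
    then show "k \<in> set_add R K (PIdl c)" using z k unfolding set_add_def' by blast
  qed
  have "c = \<zero> \<oplus> c" using c by simp
  then show "c \<in> set_add R K (PIdl c)"
    using K.zero_closed cgenideal_self[OF c] unfolding set_add_def' by blast
  show "\<exists>k\<in>K. \<exists>r\<in>carrier R. y = k \<oplus> r \<otimes> c" if "y \<in> set_add R K (PIdl c)" for y
    using that unfolding set_add_def' cgenideal_def by blast
qed

context local_artinian_ring
begin

sublocale maxi: maximalideal \<mm> R by (rule maximal)

lemma max_carr: "a \<in> \<mm> \<Longrightarrow> a \<in> carrier R"
  by (rule maxi.Icarr)

lemma one_notin_max: "\<one> \<notin> \<mm>"
  using maxi.I_notcarr maxi.one_imp_carrier by blast

text \<open>A nonunit generates a proper ideal, which lies in some maximal ideal, and \<open>\<mm>\<close> is the only one.\<close>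

lemma unit_outside_max:
  assumes a: "a \<in> carrier R" "a \<notin> \<mm>"
  shows "\<exists>b\<in>carrier R. b \<otimes> a = \<one>"
proof -
  have P: "ideal (PIdl a) R" using a(1) by (rule cgenideal_ideal)
  have "\<one> \<in> PIdl a"
  proof (rule ccontr)
    assume "\<one> \<notin> PIdl a"
    from maximal_ideal_avoiding[OF P this] obtain H where H: "ideal H R" "PIdl a \<subseteq> H" "\<one> \<notin> H"
      "\<And>H'. \<lbrakk>ideal H' R; H \<subseteq> H'; \<one> \<notin> H'\<rbrakk> \<Longrightarrow> H' = H" by blast
    have "maximalideal H R"
    proof (rule maximalidealI)
      show "carrier R \<noteq> H" using H(3) by blast
      show "J = H \<or> J = carrier R" if "ideal J R" "H \<subseteq> J" "J \<subseteq> carrier R" for J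
        using H(4)[OF that(1,2)] ideal.one_imp_carrier[OF that(1)] by blast
    qed (rule H(1))
    then have "H = \<mm>" by (rule unique_maximal)
    then show False using H(2) a cgenideal_self[OF a(1)] by blast
  qed
  then obtain b where b: "\<one> = b \<otimes> a" "b \<in> carrier R" unfolding cgenideal_def by blast
  show ?thesis using b(2) by (rule rev_bexI) (rule b(1)[symmetric])
qed

lemma unit_one_minus:
  assumes "a \<in> \<mm>"
  shows "\<exists>b\<in>carrier R. b \<otimes> (\<one> \<ominus> a) = \<one>"
proof -
  have a: "a \<in> carrier R" using assms by (rule max_carr)
  have "\<one> \<ominus> a \<notin> \<mm>"
  proof
    assume "\<one> \<ominus> a \<in> \<mm>"
    then have "(\<one> \<ominus> a) \<oplus> a \<in> \<mm>" using assms by (rule maxi.a_closed)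
    also have "(\<one> \<ominus> a) \<oplus> a = \<one>" using a by (simp add: minus_eq a_assoc l_neg)
    finally show False using one_notin_max by simp
  qed
  moreover have "\<one> \<ominus> a \<in> carrier R" using a by simp
  ultimately show ?thesis by (intro unit_outside_max)
qed

lemma max_mult_fixed_zero:
  assumes "a \<in> \<mm>" "x \<in> carrier R" "x = a \<otimes> x"
  shows "x = \<zero>"
proof -
  have a: "a \<in> carrier R" using assms by (simp add: max_carr)
  obtain b where b: "b \<in> carrier R" "b \<otimes> (\<one> \<ominus> a) = \<one>" using unit_one_minus[OF assms(1)] by blast
  have "(\<one> \<ominus> a) \<otimes> x = x \<ominus> a \<otimes> x" using a assms(2)
    by (simp add: minus_eq l_distr l_minus)
  also have "\<dots> = x \<ominus> x" by (simp only: assms(3)[symmetric])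
  also have "\<dots> = \<zero>" using assms(2) by (simp add: r_neg minus_eq)
  finally have 0: "(\<one> \<ominus> a) \<otimes> x = \<zero>" .
  have "(b \<otimes> (\<one> \<ominus> a)) \<otimes> x = b \<otimes> ((\<one> \<ominus> a) \<otimes> x)"
    using b(1) a assms(2) by (intro m_assoc) auto
  also have "\<dots> = \<zero>" unfolding 0 using b(1) by simp
  finally show ?thesis using assms(2) unfolding b(2) by simp
qed

text \<open>The descending chain condition in the form in which it is used: a property of some ideal
  holds for a minimal one.\<close>

lemma minimal_ideal:
  assumes "ideal J R" "P J"
  obtains Q where "ideal Q R" "P Q" "\<And>Q'. \<lbrakk>ideal Q' R; Q' \<subset> Q\<rbrakk> \<Longrightarrow> \<not> P Q'"
proof -
  have "wf {(I, J). ideal I R \<and> ideal J R \<and> I \<subset> J}"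
    unfolding wf_iff_no_infinite_down_chain
  proof
    assume "\<exists>f. \<forall>i. (f (Suc i), f i) \<in> {(I, J). ideal I R \<and> ideal J R \<and> I \<subset> J}"
    then obtain f where f: "\<And>i::nat. ideal (f i) R" "\<And>i. f (Suc i) \<subset> f i"
      unfolding mem_Collect_eq case_prod_conv by metis
    have "\<exists>N. \<forall>i\<ge>N. f i = f N" by (rule descending_chain) (use f in auto)
    then obtain N where "\<forall>i\<ge>N. f i = f N" ..
    then show False using f(2)[of N] by (metis le_SucI order_refl psubsetE)
  qed
  then obtain Q where "Q \<in> {Q. ideal Q R \<and> P Q}"
    "\<And>Q'. (Q', Q) \<in> {(I, J). ideal I R \<and> ideal J R \<and> I \<subset> J} \<Longrightarrow> Q' \<notin> {Q. ideal Q R \<and> P Q}"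
    using assms by (rule_tac wfE_min[where Q = "{Q. ideal Q R \<and> P Q}" and x = J]) auto
  then show ?thesis using that by blast
qed

text \<open>Nakayama's lemma for an ideal \<open>J\<close> that is not known to be finitely generated; the
  descending chain condition replaces finite generation. If \<open>\<mm> J = J \<noteq> 0\<close>, let \<open>Q\<close> be
  minimal among the ideals with \<open>Q J \<noteq> 0\<close> and pick \<open>x \<in> Q\<close> with \<open>x J \<noteq> 0\<close>. Then
  \<open>(\<mm> x) J = x (\<mm> J) = x J \<noteq> 0\<close>, so \<open>\<mm> x = Q\<close> by minimality; hence \<open>x \<in> \<mm> x\<close>, which
  forces \<open>x = 0\<close>.\<close>

lemma max_mult_proper:
  assumes J: "ideal J R" and nz: "J \<noteq> {\<zero>}"
  shows "ideal_prod R \<mm> J \<noteq> J"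
proof
  assume eq: "ideal_prod R \<mm> J = J"
  interpret J: ideal J R by fact
  obtain j1 where j1: "j1 \<in> J" "j1 \<noteq> \<zero>" using nz J.zero_closed by blast
  have "\<one> \<otimes> j1 \<noteq> \<zero>" using j1 J.Icarr by simp
  then have "\<exists>q\<in>carrier R. \<exists>j\<in>J. q \<otimes> j \<noteq> \<zero>" using j1(1) one_closed by blast
  from minimal_ideal[OF oneideal, of "\<lambda>Q. \<exists>q\<in>Q. \<exists>j\<in>J. q \<otimes> j \<noteq> \<zero>", OF this]
  obtain Q where Q: "ideal Q R" "\<exists>q\<in>Q. \<exists>j\<in>J. q \<otimes> j \<noteq> \<zero>"
    and min: "\<And>Q'. \<lbrakk>ideal Q' R; Q' \<subset> Q\<rbrakk> \<Longrightarrow> \<not> (\<exists>q\<in>Q'. \<exists>j\<in>J. q \<otimes> j \<noteq> \<zero>)" by blast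
  interpret Q: ideal Q R by fact
  obtain x j0 where x: "x \<in> Q" "j0 \<in> J" "x \<otimes> j0 \<noteq> \<zero>" using Q(2) by blast
  have xc: "x \<in> carrier R" using x Q.Icarr by blast
  have "\<exists>a\<in>\<mm>. \<exists>j\<in>J. x \<otimes> (a \<otimes> j) \<noteq> \<zero>"
  proof (rule ccontr)
    assume none: "\<not> ?thesis"
    have "y \<in> carrier R \<and> x \<otimes> y = \<zero>" if "y \<in> ideal_prod R \<mm> J" for y
      using that
    proof induction
      case (prod i j)
      then show ?case using none max_carr J.Icarr by auto
    next
      case (sum s1 s2)
      then show ?case using xc by (auto simp: r_distr)
    qed
    then show False using x eq by blast
  qed
  then obtain a j where a: "a \<in> \<mm>" "j \<in> J" "x \<otimes> (a \<otimes> j) \<noteq> \<zero>" by blast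
  \<comment> \<open>The ideal \<open>\<mm> x\<close>, which the minimality of \<open>Q\<close> makes equal to \<open>Q\<close>.\<close>
  define T where "T = (\<lambda>b. b \<otimes> x) ` \<mm>"
  have T: "ideal T R"
  proof (rule idealI)
    show "ring R" by (rule ring_axioms)
    show "subgroup T (add_monoid R)"
    proof (rule add.subgroupI)
      show "T \<subseteq> carrier R" using xc max_carr by (auto simp: T_def)
      show "T \<noteq> {}" using a by (auto simp: T_def)
      show "\<ominus> t \<in> T" if "t \<in> T" for t
        using that xc max_carr maxi.a_inv_closed unfolding T_def
        by (auto simp: l_minus[symmetric])
      show "t \<oplus> u \<in> T" if "t \<in> T" "u \<in> T" for t u
        using that xc max_carr maxi.a_closed unfolding T_def
        by (auto simp: l_distr[symmetric])
    qed
    show 1: "r \<otimes> t \<in> T" if t: "t \<in> T" and r: "r \<in> carrier R" for t r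
    proof -
      obtain b where b: "b \<in> \<mm>" "t = b \<otimes> x" using t unfolding T_def by blast
      have "r \<otimes> t = (r \<otimes> b) \<otimes> x" using b r xc max_carr by (simp add: m_assoc)
      then show ?thesis unfolding T_def using maxi.I_l_closed[OF b(1) r] by blast
    qed
    show "t \<otimes> r \<in> T" if t: "t \<in> T" and r: "r \<in> carrier R" for t r
    proof -
      have "t \<in> carrier R" using t xc max_carr unfolding T_def by auto
      then show ?thesis using 1[OF t r] r by (simp add: m_comm)
    qed
  qed
  have "T \<subseteq> Q" using x(1) Q.I_l_closed max_carr by (auto simp: T_def)
  moreover have "a \<otimes> x \<in> T" "(a \<otimes> x) \<otimes> j \<noteq> \<zero>"
    using a xc max_carr J.Icarr by (auto simp: T_def m_assoc m_lcomm)
  then have "\<not> T \<subset> Q" using min[OF T] a(2) by blast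
  ultimately have "x \<in> T" using x(1) by blast
  then obtain b where "b \<in> \<mm>" "x = b \<otimes> x" by (auto simp: T_def)
  then have "x = \<zero>" using max_mult_fixed_zero xc by blast
  then show False using x J.Icarr by auto
qed

text \<open>The quotient \<open>Y / X\<close> is zero or simple: every element of \<open>Y\<close> outside \<open>X\<close> generates it.\<close>

definition ideal_step :: "'a set \<Rightarrow> 'a set \<Rightarrow> bool" where
  "ideal_step X Y \<longleftrightarrow> X \<subseteq> Y \<and> (\<forall>c\<in>Y - X. \<forall>d\<in>Y. \<exists>k\<in>X. \<exists>q\<in>carrier R. d = k \<oplus> q \<otimes> c)"

text \<open>The ideal \<open>H\<close> is a hyperplane of the vector space \<open>J / \<mm> J\<close>. It is obtained by
  intersecting \<open>J\<close> with an ideal \<open>K \<supseteq> \<mm> J\<close> that is maximal among those avoiding some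
  \<open>x \<in> J\<close> outside \<open>\<mm> J\<close>.\<close>

lemma simple_quotient_exists:
  assumes J: "ideal J R" and nz: "J \<noteq> {\<zero>}"
  shows "\<exists>H. ideal H R \<and> H \<subset> J \<and> ideal_step H J"
proof -
  interpret J: ideal J R by fact
  let ?N = "ideal_prod R \<mm> J"
  have N: "ideal ?N R" by (rule ideal_prod_is_ideal[OF maxi.is_ideal J])
  have "?N \<subseteq> J" using ideal_prod_inter[OF maxi.is_ideal J] by blast
  then obtain x where x: "x \<in> J" "x \<notin> ?N" using max_mult_proper[OF assms] by blast
  from maximal_ideal_avoiding[OF N x(2)] obtain K where K: "ideal K R" "?N \<subseteq> K" "x \<notin> K"
    "\<And>H'. \<lbrakk>ideal H' R; K \<subseteq> H'; x \<notin> H'\<rbrakk> \<Longrightarrow> H' = K" by blast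
  interpret K: ideal K R by fact
  \<comment> \<open>Modulo \<open>K\<close>, every \<open>c \<in> J\<close> outside \<open>K\<close> is a unit multiple of \<open>x\<close>; so any two such elements are proportional.\<close>
  have split: "\<exists>r\<in>carrier R - \<mm>. x \<ominus> r \<otimes> c \<in> K" if c: "c \<in> J" "c \<notin> K" for c
  proof -
    have cc: "c \<in> carrier R" using c J.Icarr by blast
    obtain L where L: "ideal L R" "K \<subseteq> L" "c \<in> L"
      "\<forall>y\<in>L. \<exists>k\<in>K. \<exists>r\<in>carrier R. y = k \<oplus> r \<otimes> c"
      using ideal_adjoin[OF K(1) cc] by blast
    have "x \<in> L" using K(4)[OF L(1,2)] L(3) c(2) by blast
    then obtain k r where kr: "k \<in> K" "r \<in> carrier R" "x = k \<oplus> r \<otimes> c" using L(4) by blast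
    have "r \<notin> \<mm>"
    proof
      assume "r \<in> \<mm>"
      then have "r \<otimes> c \<in> K" using K(2) ideal_prod.prod[of r \<mm> c J R] c by blast
      then show False using kr K(3) K.a_closed by blast
    qed
    moreover have "x \<ominus> r \<otimes> c = k" using kr cc K.Icarr
      by (simp add: minus_eq a_assoc r_neg)
    ultimately show ?thesis using kr by blast
  qed
  show ?thesis
  proof (intro exI conjI)
    show "ideal (K \<inter> J) R" by (rule i_intersect[OF K(1) J])
    show "K \<inter> J \<subset> J" using x K(3) by blast
    show "ideal_step (K \<inter> J) J" unfolding ideal_step_def
    proof (intro conjI ballI)
      show "K \<inter> J \<subseteq> J" by blast
      fix c d assume c: "c \<in> J - K \<inter> J" and d: "d \<in> J"
      have cc: "c \<in> carrier R" "d \<in> carrier R" "x \<in> carrier R" using c d x J.Icarr by auto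
      obtain r where r: "r \<in> carrier R" "r \<notin> \<mm>" "x \<ominus> r \<otimes> c \<in> K" using split c by blast
      show "\<exists>k\<in>K \<inter> J. \<exists>q\<in>carrier R. d = k \<oplus> q \<otimes> c"
      proof (cases "d \<in> K")
        case True
        then have "d \<in> K \<inter> J" "d = d \<oplus> \<zero> \<otimes> c" using d cc by auto
        then show ?thesis by blast
      next
        case False
        then obtain t where t: "t \<in> carrier R" "t \<notin> \<mm>" "x \<ominus> t \<otimes> d \<in> K" using split d by blast
        obtain u where u: "u \<in> carrier R" "u \<otimes> t = \<one>" using unit_outside_max[OF t(1,2)] by blast
        have "u \<otimes> ((x \<ominus> r \<otimes> c) \<ominus> (x \<ominus> t \<otimes> d)) \<in> K"
          using r(3) t(3) u(1) by (auto simp: minus_eq intro!: K.I_l_closed K.a_closed K.a_inv_closed)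
        also have "(x \<ominus> r \<otimes> c) \<ominus> (x \<ominus> t \<otimes> d) = t \<otimes> d \<ominus> r \<otimes> c"
          using cc r t by algebra
        also have "u \<otimes> (t \<otimes> d \<ominus> r \<otimes> c) = (u \<otimes> t) \<otimes> d \<ominus> (u \<otimes> r) \<otimes> c"
          using cc r t u(1) by algebra
        also have "\<dots> = d \<ominus> (u \<otimes> r) \<otimes> c" using u cc by simp
        finally have "d \<ominus> (u \<otimes> r) \<otimes> c \<in> K" .
        moreover have "d \<ominus> (u \<otimes> r) \<otimes> c \<in> J" using c d u r
          by (auto simp: minus_eq intro!: J.I_l_closed J.a_closed J.a_inv_closed)
        moreover have "d = (d \<ominus> (u \<otimes> r) \<otimes> c) \<oplus> (u \<otimes> r) \<otimes> c" using cc u(1) r(1)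
          by (simp add: minus_eq a_assoc l_neg)
        ultimately show ?thesis using u r by blast
      qed
    qed
  qed
qed

text \<open>Among the ideals that are joined to \<open>R\<close> by finitely many steps there is a minimal one. It is
  zero, for a nonzero ideal could be extended downwards by one more step.\<close>

lemma ring_composition_series:
  obtains I l where "\<And>i. i \<le> l \<Longrightarrow> ideal (I i) R" "I 0 = {\<zero>}" "I l = carrier R"
    "\<And>i. i < l \<Longrightarrow> ideal_step (I i) (I (Suc i))"
proof -
  define P where "P J \<longleftrightarrow> (\<exists>I l. (\<forall>i\<le>l. ideal (I i) R) \<and> I 0 = J \<and> I l = carrier R \<and>
    (\<forall>i<l. ideal_step (I i) (I (Suc i))))" for J
  have "P (carrier R)" unfolding P_def using oneideal
    by (intro exI[of _ "\<lambda>_. carrier R"] exI[of _ 0]) auto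
  from minimal_ideal[OF oneideal, of P, OF this]
  obtain J where J: "ideal J R" "P J" "\<And>Q'. \<lbrakk>ideal Q' R; Q' \<subset> J\<rbrakk> \<Longrightarrow> \<not> P Q'" by blast
  have "J = {\<zero>}"
  proof (rule ccontr)
    assume "J \<noteq> {\<zero>}"
    then obtain H where H: "ideal H R" "H \<subset> J" "ideal_step H J"
      using simple_quotient_exists[OF J(1)] by blast
    obtain I l where I: "\<forall>i\<le>l. ideal (I i) R" "I 0 = J" "I l = carrier R"
      "\<forall>i<l. ideal_step (I i) (I (Suc i))" using J(2) unfolding P_def by blast
    have "P H" unfolding P_def
      by (rule exI[of _ "\<lambda>i. if i = 0 then H else I (i - 1)"], rule exI[of _ "Suc l"])
         (use I H in \<open>auto simp: less_Suc_eq_0_disj\<close>)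
    then show False using J(3)[OF H(1,2)] by blast
  qed
  then show ?thesis using J(2) that unfolding P_def by blast
qed

end

section \<open>Lengths of modules with a composition series\<close>

lemma (in module) smult_minus_one: "x \<in> carrier M \<Longrightarrow> \<ominus>\<^bsub>M\<^esub> x = (\<ominus> \<one>) \<odot>\<^bsub>M\<^esub> x"
  by (simp add: smult_l_minus)

lemma (in module) minus_add_cancel:
  "\<lbrakk>x \<in> carrier M; y \<in> carrier M\<rbrakk> \<Longrightarrow> (x \<ominus>\<^bsub>M\<^esub> y) \<oplus>\<^bsub>M\<^esub> y = x"
  by (simp add: M.minus_eq M.a_assoc M.l_neg)

lemma (in module) add_minus_cancel:
  "\<lbrakk>x \<in> carrier M; y \<in> carrier M\<rbrakk> \<Longrightarrow> (x \<oplus>\<^bsub>M\<^esub> y) \<ominus>\<^bsub>M\<^esub> y = x"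
  by (simp add: M.minus_eq M.a_assoc M.r_neg)

context module
begin

lemma sub_carrier: "\<lbrakk>submodule R N M; x \<in> N\<rbrakk> \<Longrightarrow> x \<in> carrier M"
  using submodule.subset by blast

lemma sub_add: "\<lbrakk>submodule R N M; x \<in> N; y \<in> N\<rbrakk> \<Longrightarrow> x \<oplus>\<^bsub>M\<^esub> y \<in> N"
  by (rule submodule.m_closed)

lemma sub_smult: "\<lbrakk>submodule R N M; r \<in> carrier R; x \<in> N\<rbrakk> \<Longrightarrow> r \<odot>\<^bsub>M\<^esub> x \<in> N"
  by (rule submodule.smult_closed)

lemma sub_zero: "submodule R N M \<Longrightarrow> \<zero>\<^bsub>M\<^esub> \<in> N"
  by (rule submodule.zero_closed)

lemma sub_minus: "\<lbrakk>submodule R N M; x \<in> N; y \<in> N\<rbrakk> \<Longrightarrow> x \<ominus>\<^bsub>M\<^esub> y \<in> N"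
  by (simp add: M.minus_eq smult_minus_one sub_carrier sub_add sub_smult)

lemma smult_swap:
  "\<lbrakk>r \<in> carrier R; s \<in> carrier R; x \<in> carrier M\<rbrakk> \<Longrightarrow> r \<odot>\<^bsub>M\<^esub> (s \<odot>\<^bsub>M\<^esub> x) = s \<odot>\<^bsub>M\<^esub> (r \<odot>\<^bsub>M\<^esub> x)"
  by (simp add: smult_assoc1[symmetric] R.m_comm)

text \<open>An introduction rule without negatives, which are multiples by \<open>- 1\<close>.\<close>

lemma submodI:
  assumes "N \<subseteq> carrier M" "\<zero>\<^bsub>M\<^esub> \<in> N" "\<And>x y. \<lbrakk>x \<in> N; y \<in> N\<rbrakk> \<Longrightarrow> x \<oplus>\<^bsub>M\<^esub> y \<in> N"
    "\<And>r x. \<lbrakk>r \<in> carrier R; x \<in> N\<rbrakk> \<Longrightarrow> r \<odot>\<^bsub>M\<^esub> x \<in> N"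
  shows "submodule R N M"
  using assms module_axioms by (simp add: submodule_def)

definition adjoin :: "'c set \<Rightarrow> 'c \<Rightarrow> 'c set" where
  "adjoin X x = {k \<oplus>\<^bsub>M\<^esub> r \<odot>\<^bsub>M\<^esub> x | k r. k \<in> X \<and> r \<in> carrier R}"

lemma adjoinE:
  assumes "y \<in> adjoin X x"
  obtains k r where "k \<in> X" "r \<in> carrier R" "y = k \<oplus>\<^bsub>M\<^esub> r \<odot>\<^bsub>M\<^esub> x"
  using assms unfolding adjoin_def by blast

lemma adjoinI: "\<lbrakk>k \<in> X; r \<in> carrier R\<rbrakk> \<Longrightarrow> k \<oplus>\<^bsub>M\<^esub> r \<odot>\<^bsub>M\<^esub> x \<in> adjoin X x"
  unfolding adjoin_def by blast

lemma adjoin_submodule: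
  assumes X: "submodule R X M" and x: "x \<in> carrier M"
  shows "submodule R (adjoin X x) M"
proof (rule submodI)
  note c = sub_carrier[OF X]
  show "adjoin X x \<subseteq> carrier M" using c x unfolding adjoin_def by auto
  have "\<zero>\<^bsub>M\<^esub> = \<zero>\<^bsub>M\<^esub> \<oplus>\<^bsub>M\<^esub> \<zero> \<odot>\<^bsub>M\<^esub> x" using x by simp
  then show "\<zero>\<^bsub>M\<^esub> \<in> adjoin X x" using sub_zero[OF X] unfolding adjoin_def by blast
  show "y \<oplus>\<^bsub>M\<^esub> z \<in> adjoin X x" if y: "y \<in> adjoin X x" and z: "z \<in> adjoin X x" for y z
  proof -
    obtain k r where k: "k \<in> X" "r \<in> carrier R" "y = k \<oplus>\<^bsub>M\<^esub> r \<odot>\<^bsub>M\<^esub> x" using y by (rule adjoinE)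
    obtain k' r' where k': "k' \<in> X" "r' \<in> carrier R" "z = k' \<oplus>\<^bsub>M\<^esub> r' \<odot>\<^bsub>M\<^esub> x" using z by (rule adjoinE)
    have "y \<oplus>\<^bsub>M\<^esub> z = (k \<oplus>\<^bsub>M\<^esub> k') \<oplus>\<^bsub>M\<^esub> (r \<oplus> r') \<odot>\<^bsub>M\<^esub> x"
      using k k' c x by (simp add: smult_l_distr M.a_ac)
    then show ?thesis using adjoinI[of "k \<oplus>\<^bsub>M\<^esub> k'" X "r \<oplus> r'" x] k k' sub_add[OF X] by simp
  qed
  show "r' \<odot>\<^bsub>M\<^esub> y \<in> adjoin X x" if r': "r' \<in> carrier R" and y: "y \<in> adjoin X x" for r' y
  proof -
    obtain k r where k: "k \<in> X" "r \<in> carrier R" "y = k \<oplus>\<^bsub>M\<^esub> r \<odot>\<^bsub>M\<^esub> x" using y by (rule adjoinE)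
    have "r' \<odot>\<^bsub>M\<^esub> y = r' \<odot>\<^bsub>M\<^esub> k \<oplus>\<^bsub>M\<^esub> (r' \<otimes> r) \<odot>\<^bsub>M\<^esub> x"
      using k r' c x by (simp add: smult_r_distr smult_assoc1)
    then show ?thesis using adjoinI[of "r' \<odot>\<^bsub>M\<^esub> k" X "r' \<otimes> r" x] k r' sub_smult[OF X] by simp
  qed
qed

lemma adjoin_superset:
  assumes "submodule R X M" "x \<in> carrier M"
  shows "X \<subseteq> adjoin X x"
proof
  fix k assume k: "k \<in> X"
  then have "k = k \<oplus>\<^bsub>M\<^esub> \<zero> \<odot>\<^bsub>M\<^esub> x" using assms sub_carrier by simp
  then show "k \<in> adjoin X x" using k adjoinI[of k X \<zero> x] by simp
qed

lemma adjoin_self: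
  assumes "submodule R X M" "x \<in> carrier M"
  shows "x \<in> adjoin X x"
proof -
  have "x = \<zero>\<^bsub>M\<^esub> \<oplus>\<^bsub>M\<^esub> \<one> \<odot>\<^bsub>M\<^esub> x" using assms(2) by simp
  then show ?thesis using adjoinI[of "\<zero>\<^bsub>M\<^esub>" X \<one> x] sub_zero[OF assms(1)] by simp
qed

lemma adjoin_least:
  assumes "submodule R Z M" "X \<subseteq> Z" "x \<in> Z"
  shows "adjoin X x \<subseteq> Z"
  using assms sub_add sub_smult unfolding adjoin_def by blast

text \<open>The quotient \<open>Y / X\<close> is zero or simple. Zero is admitted because passing to
  orthogonals may turn a proper step into an equality.\<close>

definition module_step :: "'c set \<Rightarrow> 'c set \<Rightarrow> bool" where
  "module_step X Y \<longleftrightarrow> X \<subseteq> Y \<and>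
    (\<forall>c\<in>Y - X. \<forall>d\<in>Y. \<exists>k\<in>X. \<exists>q\<in>carrier R. d = k \<oplus>\<^bsub>M\<^esub> q \<odot>\<^bsub>M\<^esub> c)"

lemma module_stepD:
  assumes "module_step X Y" "c \<in> Y" "c \<notin> X" "d \<in> Y"
  obtains k q where "k \<in> X" "q \<in> carrier R" "d = k \<oplus>\<^bsub>M\<^esub> q \<odot>\<^bsub>M\<^esub> c"
  using assms unfolding module_step_def by blast

end

locale local_module = R?: local_artinian_ring R \<mm> + module R M
  for R (structure) and \<mm> and M
begin

text \<open>If \<open>a y\<close> were outside \<open>X\<close>, it would generate \<open>Y / X\<close>, so that \<open>y = q a y\<close> modulo
  \<open>X\<close>; but \<open>1 - q a\<close> is a unit.\<close>

lemma module_step_max: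
  assumes st: "module_step X Y" and X: "submodule R X M" and Y: "submodule R Y M"
    and a: "a \<in> \<mm>" and y: "y \<in> Y"
  shows "a \<odot>\<^bsub>M\<^esub> y \<in> X"
proof (rule ccontr)
  assume n: "a \<odot>\<^bsub>M\<^esub> y \<notin> X"
  have ac: "a \<in> carrier R" using a by (rule max_carr)
  have yc: "y \<in> carrier M" using y Y sub_carrier by blast
  have "a \<odot>\<^bsub>M\<^esub> y \<in> Y" using sub_smult[OF Y ac y] .
  from module_stepD[OF st this n y] obtain k q
    where k: "k \<in> X" "q \<in> carrier R" "y = k \<oplus>\<^bsub>M\<^esub> q \<odot>\<^bsub>M\<^esub> (a \<odot>\<^bsub>M\<^esub> y)" by blast
  have kc: "k \<in> carrier M" using k X sub_carrier by blast
  have "q \<otimes> a \<in> \<mm>" using a k(2) by (rule maxi.I_l_closed)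
  from unit_one_minus[OF this] obtain b where b: "b \<in> carrier R" "b \<otimes> (\<one> \<ominus> q \<otimes> a) = \<one>" by blast
  have "(\<one> \<ominus> q \<otimes> a) \<odot>\<^bsub>M\<^esub> y = y \<ominus>\<^bsub>M\<^esub> q \<odot>\<^bsub>M\<^esub> (a \<odot>\<^bsub>M\<^esub> y)"
    using ac yc k(2) by (simp add: R.minus_eq M.minus_eq smult_l_distr smult_l_minus smult_assoc1)
  also have "\<dots> = (k \<oplus>\<^bsub>M\<^esub> q \<odot>\<^bsub>M\<^esub> (a \<odot>\<^bsub>M\<^esub> y)) \<ominus>\<^bsub>M\<^esub> q \<odot>\<^bsub>M\<^esub> (a \<odot>\<^bsub>M\<^esub> y)"
    using k(3) by (rule arg_cong)
  also have "\<dots> = k" using ac yc k(2) kc by (intro add_minus_cancel) auto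
  finally have e: "(\<one> \<ominus> q \<otimes> a) \<odot>\<^bsub>M\<^esub> y = k" .
  have "y = (b \<otimes> (\<one> \<ominus> q \<otimes> a)) \<odot>\<^bsub>M\<^esub> y" using yc unfolding b(2) by simp
  also have "\<dots> = b \<odot>\<^bsub>M\<^esub> k" unfolding e[symmetric] using b(1) k(2) ac yc by (intro smult_assoc1) auto
  finally have "y \<in> X" using sub_smult[OF X b(1) k(1)] by simp
  then show False using n sub_smult[OF X ac] by blast
qed

text \<open>An element \<open>k + r x\<close> outside \<open>X\<close> has \<open>r \<notin> \<mm>\<close>, so \<open>r\<close> is a unit and \<open>x\<close> can be recovered
  from it.\<close>

lemma module_step_adjoin:
  assumes X: "submodule R X M" and x: "x \<in> carrier M" and m: "\<forall>a\<in>\<mm>. a \<odot>\<^bsub>M\<^esub> x \<in> X"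
  shows "module_step X (adjoin X x)"
  unfolding module_step_def
proof (intro conjI ballI)
  show "X \<subseteq> adjoin X x" by (rule adjoin_superset[OF X x])
  fix c d assume c: "c \<in> adjoin X x - X" and d: "d \<in> adjoin X x"
  obtain k r where k: "k \<in> X" "r \<in> carrier R" "c = k \<oplus>\<^bsub>M\<^esub> r \<odot>\<^bsub>M\<^esub> x" using c by (blast elim: adjoinE)
  obtain k' r' where k': "k' \<in> X" "r' \<in> carrier R" "d = k' \<oplus>\<^bsub>M\<^esub> r' \<odot>\<^bsub>M\<^esub> x" using d by (rule adjoinE)
  have kc: "k \<in> carrier M" "k' \<in> carrier M" using k k' X sub_carrier by blast+
  have "r \<notin> \<mm>" using c k m sub_add[OF X] by auto
  from unit_outside_max[OF k(2) this] obtain u where u: "u \<in> carrier R" "u \<otimes> r = \<one>" by blast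
  let ?q = "r' \<otimes> u"
  have "?q \<otimes> r = r'" using u k(2) k'(2) by (simp add: m_assoc)
  then have "?q \<odot>\<^bsub>M\<^esub> c = ?q \<odot>\<^bsub>M\<^esub> k \<oplus>\<^bsub>M\<^esub> r' \<odot>\<^bsub>M\<^esub> x"
    using u(1) k k'(2) kc x by (simp add: smult_r_distr smult_assoc1[symmetric] del: smult_assoc1)
  then have "(k' \<ominus>\<^bsub>M\<^esub> ?q \<odot>\<^bsub>M\<^esub> k) \<oplus>\<^bsub>M\<^esub> ?q \<odot>\<^bsub>M\<^esub> c = ((k' \<ominus>\<^bsub>M\<^esub> ?q \<odot>\<^bsub>M\<^esub> k) \<oplus>\<^bsub>M\<^esub> ?q \<odot>\<^bsub>M\<^esub> k) \<oplus>\<^bsub>M\<^esub> r' \<odot>\<^bsub>M\<^esub> x"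
    using u(1) k(2) k'(2) kc x by (simp add: M.a_assoc)
  also have "\<dots> = d" using u(1) k'(2,3) kc by (simp add: minus_add_cancel)
  finally have "d = (k' \<ominus>\<^bsub>M\<^esub> ?q \<odot>\<^bsub>M\<^esub> k) \<oplus>\<^bsub>M\<^esub> ?q \<odot>\<^bsub>M\<^esub> c" ..
  moreover have "k' \<ominus>\<^bsub>M\<^esub> ?q \<odot>\<^bsub>M\<^esub> k \<in> X" using X k k' u(1) by (intro sub_minus sub_smult) auto
  ultimately show "\<exists>k\<in>X. \<exists>q\<in>carrier R. d = k \<oplus>\<^bsub>M\<^esub> q \<odot>\<^bsub>M\<^esub> c" using u(1) k'(2) by blast
qed

end

locale finite_length_module = local_module +
  fixes A :: "nat \<Rightarrow> 'c set" and l :: nat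
  assumes series_submodule: "i \<le> l \<Longrightarrow> submodule R (A i) M"
    and series_bottom: "A 0 = {\<zero>\<^bsub>M\<^esub>}"
    and series_top: "A l = carrier M"
    and series_step: "i < l \<Longrightarrow> module_step (A i) (A (Suc i))"
begin

definition jumps :: "'c set \<Rightarrow> nat set" where
  "jumps C = {i. i < l \<and> \<not> C \<inter> A (Suc i) \<subseteq> A i}"

text \<open>For a submodule \<open>C\<close> the subquotients of the series \<open>C \<inter> A i\<close> embed into those of
  \<open>A\<close>, so counting the nonzero ones gives the length of \<open>C\<close>.\<close>

definition len :: "'c set \<Rightarrow> nat" where
  "len C = card (jumps C)"

lemma finite_jumps [simp]: "finite (jumps C)"
  by (simp add: jumps_def)

lemma series_mono: "\<lbrakk>i \<le> j; j \<le> l\<rbrakk> \<Longrightarrow> A i \<subseteq> A j"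
proof (induction j rule: dec_induct)
  case (step n)
  then have "A n \<subseteq> A (Suc n)" using series_step[of n] unfolding module_step_def by auto
  then show ?case using step by auto
qed simp

lemma len_mono: "C \<subseteq> D \<Longrightarrow> len C \<le> len D"
  unfolding len_def by (rule card_mono) (auto simp: jumps_def)

lemma len_zero: "len {\<zero>\<^bsub>M\<^esub>} = 0"
proof -
  have "jumps {\<zero>\<^bsub>M\<^esub>} = {}" unfolding jumps_def
    using sub_zero[OF series_submodule] by auto
  then show ?thesis by (simp add: len_def)
qed

lemma len_le: "len C \<le> l"
proof -
  have "jumps C \<subseteq> {..<l}" by (auto simp: jumps_def)
  then have "card (jumps C) \<le> card {..<l}" by (intro card_mono) auto
  then show ?thesis by (simp add: len_def)
qed

text \<open>The length is strictly monotone. When \<open>C\<close> and \<open>D\<close> grow at the same places of the series,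
  an element of \<open>D\<close> in \<open>A (i + 1)\<close> is a multiple of an element of \<open>C\<close> up to an element of
  \<open>D \<inter> A i\<close>, which is in \<open>C\<close> by induction on \<open>i\<close>.\<close>

lemma eq_if_len_le:
  assumes C: "submodule R C M" and D: "submodule R D M" and CD: "C \<subseteq> D" and le: "len D \<le> len C"
  shows "C = D"
proof -
  have "jumps C \<subseteq> jumps D" using CD by (auto simp: jumps_def)
  then have J: "jumps C = jumps D" using le unfolding len_def by (intro card_seteq) auto
  have "D \<inter> A i \<subseteq> C" if "i \<le> l" for i
    using that
  proof (induction i)
    case 0
    then show ?case using series_bottom sub_zero[OF C] by auto
  next
    case (Suc i)
    show ?case
    proof
      fix d assume d: "d \<in> D \<inter> A (Suc i)"
      show "d \<in> C"
      proof (cases "i \<in> jumps D")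
        case False
        then have "d \<in> A i" using d Suc.prems by (auto simp: jumps_def)
        then show ?thesis using d Suc by auto
      next
        case True
        then have "i \<in> jumps C" using J by simp
        then obtain c where c: "c \<in> C" "c \<in> A (Suc i)" "c \<notin> A i"
          unfolding jumps_def by blast
        have "i < l" using Suc.prems by simp
        from module_stepD[OF series_step[OF this] c(2,3), of d] d obtain k q
          where k: "k \<in> A i" "q \<in> carrier R" "d = k \<oplus>\<^bsub>M\<^esub> q \<odot>\<^bsub>M\<^esub> c" by blast
        have kc: "k \<in> carrier M" "c \<in> carrier M"
          using k c C sub_carrier series_submodule[of i] Suc.prems by auto
        have "k = d \<ominus>\<^bsub>M\<^esub> q \<odot>\<^bsub>M\<^esub> c" using k(2,3) kc by (simp add: add_minus_cancel)
        also have "\<dots> \<in> D" using d c CD k(2) by (intro sub_minus[OF D] sub_smult[OF D]) auto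
        finally have "k \<in> C" using k(1) Suc by auto
        then show ?thesis unfolding k(3) using c k(2) by (intro sub_add[OF C] sub_smult[OF C]) auto
      qed
    qed
  qed
  from this[of l] show ?thesis using CD series_top sub_carrier[OF D] by auto
qed

text \<open>Suppose that \<open>Y\<close> grows and \<open>X\<close> does not at two places \<open>i < j\<close>, witnessed by \<open>y\<close> and \<open>z\<close>.
  As \<open>Y / X\<close> is generated by \<open>y\<close>, some \<open>k = z - q y\<close> is in \<open>X\<close>; but \<open>y\<close> is already in
  \<open>A j\<close>, so \<open>k\<close> witnesses that \<open>X\<close> grows at \<open>j\<close> after all.\<close>

lemma len_step:
  assumes st: "module_step X Y" and X: "submodule R X M" and Y: "submodule R Y M"
  shows "len Y \<le> len X + 1"
proof -
  have key: False if i: "i \<in> jumps Y - jumps X" and j: "j \<in> jumps Y - jumps X" and ij: "i < j" for i j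
  proof -
    obtain y where y: "y \<in> Y" "y \<in> A (Suc i)" "y \<notin> A i" using i by (auto simp: jumps_def)
    obtain z where z: "z \<in> Y" "z \<in> A (Suc j)" "z \<notin> A j" using j by (auto simp: jumps_def)
    have jl: "j < l" using j by (auto simp: jumps_def)
    have "y \<notin> X" using y i by (auto simp: jumps_def)
    from module_stepD[OF st y(1) this z(1)] obtain k q
      where k: "k \<in> X" "q \<in> carrier R" "z = k \<oplus>\<^bsub>M\<^esub> q \<odot>\<^bsub>M\<^esub> y" by blast
    have c: "k \<in> carrier M" "y \<in> carrier M" using k y X Y sub_carrier by blast+
    have Aj: "submodule R (A j) M" "submodule R (A (Suc j)) M" using series_submodule jl by auto
    have yj: "y \<in> A j" "y \<in> A (Suc j)"
      using y(2) series_mono[of "Suc i" j] series_mono[of "Suc i" "Suc j"] ij jl by auto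
    have "k = z \<ominus>\<^bsub>M\<^esub> q \<odot>\<^bsub>M\<^esub> y" using k(2,3) c by (simp add: add_minus_cancel)
    also have "\<dots> \<in> A (Suc j)" using z k(2) yj by (intro sub_minus[OF Aj(2)] sub_smult[OF Aj(2)]) auto
    finally have "k \<in> A (Suc j)" .
    moreover have "k \<notin> A j"
    proof
      assume "k \<in> A j"
      then have "z \<in> A j" unfolding k(3) using k(2) yj by (intro sub_add[OF Aj(1)] sub_smult[OF Aj(1)])
      then show False using z by simp
    qed
    ultimately show False using k(1) j by (auto simp: jumps_def)
  qed
  have "i = j" if "i \<in> jumps Y - jumps X" "j \<in> jumps Y - jumps X" for i j
    using key[OF that] key[OF that(2,1)] by (cases i j rule: linorder_cases) auto
  then have "card (jumps Y - jumps X) \<le> 1"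
    by (simp only: One_nat_def card_le_Suc0_iff_eq finite_Diff finite_jumps) blast
  moreover have "card (jumps Y) \<le> card (jumps X) + card (jumps Y - jumps X)"
    using card_mono[of "jumps X \<union> (jumps Y - jumps X)" "jumps Y"] card_Un_le[of "jumps X" "jumps Y - jumps X"]
    by auto
  ultimately show ?thesis by (simp add: len_def)
qed

text \<open>The socle of \<open>Y / X\<close> is nonzero: take an element of \<open>Y\<close> outside \<open>X\<close> that occurs as early as
  possible in the series.\<close>

lemma socle_of_quotient:
  assumes X: "submodule R X M" and Y: "submodule R Y M" and XY: "X \<subset> Y"
  shows "\<exists>x\<in>Y. x \<notin> X \<and> (\<forall>a\<in>\<mm>. a \<odot>\<^bsub>M\<^esub> x \<in> X)"
proof -
  define i where "i = (LEAST i. \<not> Y \<inter> A i \<subseteq> X)"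
  have l: "\<not> Y \<inter> A l \<subseteq> X" using XY series_top sub_carrier[OF Y] by auto
  then have i: "\<not> Y \<inter> A i \<subseteq> X" unfolding i_def by (rule LeastI)
  have il: "i \<le> l" unfolding i_def using l by (rule Least_le)
  have "i \<noteq> 0" using i series_bottom sub_zero[OF X] by (intro notI) auto
  then obtain j where j: "i = Suc j" by (cases i) auto
  have "Y \<inter> A j \<subseteq> X" using not_less_Least[of j "\<lambda>i. \<not> Y \<inter> A i \<subseteq> X"] j unfolding i_def by auto
  moreover obtain x where x: "x \<in> Y" "x \<in> A (Suc j)" "x \<notin> X" using i j by blast
  moreover have "a \<odot>\<^bsub>M\<^esub> x \<in> Y \<inter> A j" if "a \<in> \<mm>" for a
    using module_step_max[OF series_step series_submodule series_submodule that x(2)] il j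
      sub_smult[OF Y max_carr[OF that] x(1)] by auto
  ultimately show ?thesis by blast
qed

lemma len_adjoin:
  assumes X: "submodule R X M" and x: "x \<in> carrier M" "x \<notin> X" and m: "\<forall>a\<in>\<mm>. a \<odot>\<^bsub>M\<^esub> x \<in> X"
  shows "len (adjoin X x) = len X + 1"
proof -
  have "len (adjoin X x) \<le> len X + 1"
    by (rule len_step[OF module_step_adjoin[OF X x(1) m] X adjoin_submodule[OF X x(1)]])
  moreover have "\<not> len (adjoin X x) \<le> len X"
    using eq_if_len_le[OF X adjoin_submodule[OF X x(1)] adjoin_superset[OF X x(1)]]
      adjoin_self[OF X x(1)] x(2) by auto
  ultimately show ?thesis by simp
qed

text \<open>Induction from \<open>X\<close> up to \<open>Y\<close> along simple quotients. A submodule of maximal length between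
  them that satisfies \<open>P\<close> must be \<open>Y\<close>, since otherwise the socle of the quotient allows one more
  step.\<close>

lemma submodule_chain_induct [consumes 3, case_names base adjoin]:
  assumes X: "submodule R X M" and Y: "submodule R Y M" and XY: "X \<subseteq> Y"
    and base: "P X"
    and step: "\<And>Z x. \<lbrakk>submodule R Z M; X \<subseteq> Z; Z \<subseteq> Y; P Z; x \<in> Y; x \<notin> Z; \<forall>a\<in>\<mm>. a \<odot>\<^bsub>M\<^esub> x \<in> Z\<rbrakk>
      \<Longrightarrow> P (adjoin Z x)"
  shows "P Y"
proof -
  let ?Q = "\<lambda>Z. submodule R Z M \<and> X \<subseteq> Z \<and> Z \<subseteq> Y \<and> P Z"
  have "\<exists>Z. ?Q Z \<and> (\<forall>Z'. ?Q Z' \<longrightarrow> len Z' \<le> len Z)"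
    by (rule ex_has_greatest_nat[where b = "Suc l" and k = X]) (use X XY base len_le in \<open>auto simp: less_Suc_eq_le\<close>)
  then obtain Z where Z: "?Q Z" "\<And>Z'. ?Q Z' \<Longrightarrow> len Z' \<le> len Z" by blast
  have "Z = Y"
  proof (rule ccontr)
    assume "Z \<noteq> Y"
    then have "Z \<subset> Y" using Z(1) by blast
    from socle_of_quotient[OF _ Y this] Z(1) obtain x
      where x: "x \<in> Y" "x \<notin> Z" "\<forall>a\<in>\<mm>. a \<odot>\<^bsub>M\<^esub> x \<in> Z" by blast
    have xc: "x \<in> carrier M" using x Y sub_carrier by blast
    have "?Q (adjoin Z x)"
      using Z(1) x adjoin_submodule[OF _ xc] adjoin_superset[OF _ xc] adjoin_least[OF Y] step by blast
    from Z(2)[OF this] len_adjoin[OF _ xc x(2,3)] Z(1) show False by simp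
  qed
  then show ?thesis using Z(1) by blast
qed

end

section \<open>Free modules of tuples and the dot product\<close>

context cring
begin

lemma tuples_module: "module R (tuples R n)"
  by (rule func_space_is_module)

lemma tuples_carrier: "carrier (tuples R n) = {..<n} \<rightarrow>\<^sub>E carrier R"
  by (simp add: func_space_def)

lemma tuples_nth_closed: "\<lbrakk>v \<in> carrier (tuples R n); i < n\<rbrakk> \<Longrightarrow> v i \<in> carrier R"
  by (auto simp: tuples_carrier PiE_def Pi_def)

lemma tuples_restrictI: "(\<And>i. i < n \<Longrightarrow> f i \<in> carrier R) \<Longrightarrow> restrict f {..<n} \<in> carrier (tuples R n)"
  by (simp add: tuples_carrier)

lemma tuples_add_nth: "i < n \<Longrightarrow> (u \<oplus>\<^bsub>tuples R n\<^esub> v) i = u i \<oplus> v i"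
  by (simp add: func_space_def)

lemma tuples_smult_nth: "i < n \<Longrightarrow> (r \<odot>\<^bsub>tuples R n\<^esub> v) i = r \<otimes> v i"
  by (simp add: func_space_def)

lemma tuples_zero_nth: "i < n \<Longrightarrow> \<zero>\<^bsub>tuples R n\<^esub> i = \<zero>"
  by (simp add: func_space_def)

lemma tuples_eqI:
  assumes "u \<in> carrier (tuples R n)" "v \<in> carrier (tuples R n)" "\<And>i. i < n \<Longrightarrow> u i = v i"
  shows "u = v"
  using assms unfolding tuples_carrier by (intro PiE_ext) auto

lemma tuples_minus_nth:
  assumes u: "u \<in> carrier (tuples R n)" and v: "v \<in> carrier (tuples R n)" and i: "i < n"
  shows "(u \<ominus>\<^bsub>tuples R n\<^esub> v) i = u i \<ominus> v i"
proof -
  interpret T: module R "tuples R n" by (rule tuples_module)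
  have "(u \<ominus>\<^bsub>tuples R n\<^esub> v) i \<oplus> v i = u i"
    using T.minus_add_cancel[OF u v] tuples_add_nth[OF i, of "u \<ominus>\<^bsub>tuples R n\<^esub> v" v] by simp
  moreover have "(u \<ominus>\<^bsub>tuples R n\<^esub> v) i \<in> carrier R" using u v i by (intro tuples_nth_closed) auto
  ultimately show ?thesis using tuples_nth_closed[OF v i]
    by (metis add.inv_solve_right' minus_eq a_minus_def tuples_nth_closed[OF u i])
qed

definition tuple_at :: "nat \<Rightarrow> nat \<Rightarrow> 'a \<Rightarrow> nat \<Rightarrow> 'a" where
  "tuple_at n j a = (\<lambda>i\<in>{..<n}. if i = j then a else \<zero>)"

lemma tuple_at_carrier: "a \<in> carrier R \<Longrightarrow> tuple_at n j a \<in> carrier (tuples R n)"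
  unfolding tuple_at_def by (rule tuples_restrictI) simp

lemma tuple_at_nth: "i < n \<Longrightarrow> tuple_at n j a i = (if i = j then a else \<zero>)"
  by (simp add: tuple_at_def)

definition dot :: "nat \<Rightarrow> (nat \<Rightarrow> 'a) \<Rightarrow> (nat \<Rightarrow> 'a) \<Rightarrow> 'a" where
  "dot n v w = (\<Oplus>i\<in>{..<n}. v i \<otimes> w i)"

lemma dot_closed:
  "\<lbrakk>v \<in> carrier (tuples R n); w \<in> carrier (tuples R n)\<rbrakk> \<Longrightarrow> dot n v w \<in> carrier R"
  unfolding dot_def by (intro finsum_closed Pi_I m_closed) (simp_all add: tuples_nth_closed)

lemma dot_comm:
  assumes "v \<in> carrier (tuples R n)" "w \<in> carrier (tuples R n)"
  shows "dot n v w = dot n w v"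
  unfolding dot_def using assms
  by (intro finsum_cong') (auto simp: m_comm tuples_nth_closed)

lemma dot_add_left:
  assumes u: "u \<in> carrier (tuples R n)" and v: "v \<in> carrier (tuples R n)"
    and w: "w \<in> carrier (tuples R n)"
  shows "dot n (u \<oplus>\<^bsub>tuples R n\<^esub> v) w = dot n u w \<oplus> dot n v w"
proof -
  have "dot n (u \<oplus>\<^bsub>tuples R n\<^esub> v) w = (\<Oplus>i\<in>{..<n}. u i \<otimes> w i \<oplus> v i \<otimes> w i)"
    unfolding dot_def using assms
    by (intro finsum_cong') (auto simp: tuples_add_nth l_distr tuples_nth_closed)
  also have "\<dots> = dot n u w \<oplus> dot n v w"
    unfolding dot_def using assms by (intro finsum_addf) (auto simp: tuples_nth_closed)
  finally show ?thesis .
qed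

lemma dot_smult_left:
  assumes r: "r \<in> carrier R" and v: "v \<in> carrier (tuples R n)" and w: "w \<in> carrier (tuples R n)"
  shows "dot n (r \<odot>\<^bsub>tuples R n\<^esub> v) w = r \<otimes> dot n v w"
proof -
  have "r \<otimes> dot n v w = (\<Oplus>i\<in>{..<n}. r \<otimes> (v i \<otimes> w i))"
    unfolding dot_def using assms by (intro finsum_rdistr) (auto simp: tuples_nth_closed)
  also have "\<dots> = dot n (r \<odot>\<^bsub>tuples R n\<^esub> v) w"
    unfolding dot_def using assms
    by (intro finsum_cong') (auto simp: tuples_smult_nth m_assoc tuples_nth_closed)
  finally show ?thesis ..
qed

lemma dot_tuple_at:
  assumes a: "a \<in> carrier R" and j: "j < n" and v: "v \<in> carrier (tuples R n)"
  shows "dot n (tuple_at n j a) v = a \<otimes> v j"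
proof -
  have "dot n (tuple_at n j a) v = (\<Oplus>i\<in>{..<n}. if j = i then a \<otimes> v i else \<zero>)"
    unfolding dot_def using assms
    by (intro finsum_cong') (auto simp: tuple_at_nth tuples_nth_closed)
  also have "\<dots> = a \<otimes> v j" using assms
    by (intro finsum_singleton) (auto simp: tuples_nth_closed)
  finally show ?thesis .
qed

lemma orthogonal_alt:
  "orthogonal R n C = {v \<in> carrier (tuples R n). \<forall>w\<in>C. dot n v w = \<zero>}"
  by (simp add: orthogonal_def dot_def)

lemma dot_zero_left:
  assumes "w \<in> carrier (tuples R n)"
  shows "dot n \<zero>\<^bsub>tuples R n\<^esub> w = \<zero>"
proof -
  have "dot n \<zero>\<^bsub>tuples R n\<^esub> w = (\<Oplus>i\<in>{..<n}. \<zero>)"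
    unfolding dot_def using assms
    by (intro finsum_cong') (auto simp: tuples_zero_nth tuples_nth_closed)
  then show ?thesis by simp
qed

lemma orthogonal_submodule:
  assumes C: "submodule R C (tuples R n)"
  shows "submodule R (orthogonal R n C) (tuples R n)"
proof -
  interpret T: module R "tuples R n" by (rule tuples_module)
  note c = T.sub_carrier[OF C]
  show ?thesis
  proof (rule T.submodI)
    show "orthogonal R n C \<subseteq> carrier (tuples R n)" by (auto simp: orthogonal_alt)
    show "\<zero>\<^bsub>tuples R n\<^esub> \<in> orthogonal R n C" by (auto simp: orthogonal_alt dot_zero_left c)
    show "x \<oplus>\<^bsub>tuples R n\<^esub> y \<in> orthogonal R n C"
      if "x \<in> orthogonal R n C" "y \<in> orthogonal R n C" for x y
      using that by (auto simp: orthogonal_alt dot_add_left c)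
    show "r \<odot>\<^bsub>tuples R n\<^esub> x \<in> orthogonal R n C"
      if "r \<in> carrier R" "x \<in> orthogonal R n C" for r x
      using that by (auto simp: orthogonal_alt dot_smult_left c)
  qed
qed

lemma orthogonal_antimono: "C \<subseteq> D \<Longrightarrow> orthogonal R n D \<subseteq> orthogonal R n C"
  by (auto simp: orthogonal_alt)

lemma orthogonal_zero: "orthogonal R n {\<zero>\<^bsub>tuples R n\<^esub>} = carrier (tuples R n)"
proof -
  interpret T: module R "tuples R n" by (rule tuples_module)
  have "dot n v \<zero>\<^bsub>tuples R n\<^esub> = \<zero>" if "v \<in> carrier (tuples R n)" for v
    using dot_comm[OF that T.zero_closed] dot_zero_left[OF that] by simp
  then show ?thesis by (auto simp: orthogonal_alt)
qed

lemma orthogonal_carrier: "orthogonal R n (carrier (tuples R n)) = {\<zero>\<^bsub>tuples R n\<^esub>}"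
proof -
  interpret T: module R "tuples R n" by (rule tuples_module)
  have "v = \<zero>\<^bsub>tuples R n\<^esub>"
    if v: "v \<in> carrier (tuples R n)" "\<forall>w\<in>carrier (tuples R n). dot n v w = \<zero>" for v
  proof (rule tuples_eqI[OF v(1) T.zero_closed])
    fix i assume i: "i < n"
    have "v i = dot n (tuple_at n i \<one>) v" using dot_tuple_at[OF one_closed i v(1)] i v(1)
      by (simp add: tuples_nth_closed)
    also have "\<dots> = dot n v (tuple_at n i \<one>)" by (intro dot_comm tuple_at_carrier v) simp
    also have "\<dots> = \<zero>" using v(2) tuple_at_carrier[OF one_closed] by blast
    finally show "v i = \<zero>\<^bsub>tuples R n\<^esub> i" using i by (simp add: tuples_zero_nth)
  qed
  then show ?thesis by (auto simp: orthogonal_alt dot_zero_left)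
qed

lemma orthogonal_orthogonal:
  assumes C: "submodule R C (tuples R n)"
  shows "C \<subseteq> orthogonal R n (orthogonal R n C)"
proof -
  interpret T: module R "tuples R n" by (rule tuples_module)
  note c = T.sub_carrier[OF C]
  have "dot n v w = \<zero>" if "v \<in> C" "w \<in> orthogonal R n C" for v w
    using that c[OF that(1)] by (subst dot_comm) (auto simp: orthogonal_alt)
  then show ?thesis using c by (auto simp: orthogonal_alt[of n "orthogonal R n C"])
qed

end

text \<open>Elements of \<open>R^n\<close> are filled in one coordinate after the other, each along a composition series
  of \<open>R\<close> of length \<open>l\<close>. After \<open>q\<close> steps the coordinate \<open>k\<close> has reached the index
  \<open>min l (q - k l)\<close>, by truncated subtraction; the next step concerns the coordinate \<open>q div l\<close> only.\<close>

lemma series_index_step: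
  fixes l q k :: nat
  assumes "k \<noteq> q div l" and "0 < l"
  shows "min l (Suc q - k * l) = min l (q - k * l)"
proof (cases "k < q div l")
  case True
  then have "Suc k * l \<le> q div l * l" by (intro mult_le_mono1) simp
  also have "\<dots> \<le> q" by (simp add: div_times_less_eq_dividend)
  finally show ?thesis by (simp add: min_def)
next
  case False
  then have "Suc (q div l) * l \<le> k * l" using assms(1) by (intro mult_le_mono1) simp
  moreover have "q < Suc (q div l) * l" using assms(2) dividend_less_div_times[of l q] by (simp add: mult.commute)
  ultimately show ?thesis by simp
qed

context local_artinian_ring
begin

lemma tuples_local_module: "local_module R \<mm> (tuples R n)"
  by (intro local_module.intro local_artinian_ring_axioms tuples_module)

lemma tuples_finite_length: "\<exists>A L. finite_length_module R \<mm> (tuples R n) A L"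
proof -
  let ?T = "tuples R n"
  interpret T: local_module R \<mm> ?T by (rule tuples_local_module)
  obtain I l where I: "\<And>i. i \<le> l \<Longrightarrow> ideal (I i) R" "I 0 = {\<zero>}" "I l = carrier R"
    "\<And>i. i < l \<Longrightarrow> ideal_step (I i) (I (Suc i))"
    by (rule ring_composition_series) blast
  have l: "0 < l"
  proof (rule ccontr)
    assume "\<not> 0 < l"
    then have "carrier R = {\<zero>}" using I(2,3) by simp
    then have "\<one> = \<zero>" using one_closed by blast
    then show False using one_notin_max maxi.zero_closed by simp
  qed
  define e where "e q k = min l (q - k * l)" for q k :: nat
  have el: "e q k \<le> l" for q k by (simp add: e_def)
  define A where "A q = {v \<in> carrier ?T. \<forall>k<n. v k \<in> I (e q k)}" for q
  have sub: "submodule R (A q) ?T" for q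
  proof (rule T.submodI)
    note id = ideal.axioms(1)[OF I(1)[OF el]]
    show "A q \<subseteq> carrier ?T" by (auto simp: A_def)
    show "\<zero>\<^bsub>?T\<^esub> \<in> A q" using additive_subgroup.zero_closed[OF id]
      by (auto simp: A_def tuples_zero_nth)
    show "x \<oplus>\<^bsub>?T\<^esub> y \<in> A q" if "x \<in> A q" "y \<in> A q" for x y
      using that additive_subgroup.a_closed[OF id] by (auto simp: A_def tuples_add_nth)
    show "r \<odot>\<^bsub>?T\<^esub> x \<in> A q" if "r \<in> carrier R" "x \<in> A q" for r x
      using that ideal.I_l_closed[OF I(1)[OF el]] by (auto simp: A_def tuples_smult_nth)
  qed
  have "finite_length_module R \<mm> ?T A (n * l)"
  proof (intro finite_length_module.intro finite_length_module_axioms.intro tuples_local_module)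
    show "submodule R (A i) ?T" for i by (rule sub)
    have "v = \<zero>\<^bsub>?T\<^esub>" if "v \<in> A 0" for v
      using that I(2) by (intro tuples_eqI) (auto simp: A_def e_def tuples_zero_nth)
    then show "A 0 = {\<zero>\<^bsub>?T\<^esub>}" using T.sub_zero[OF sub] by blast
    have "e (n * l) k = l" if "k < n" for k
    proof -
      have "Suc k * l \<le> n * l" using that by (intro mult_le_mono1) simp
      then show ?thesis by (simp add: e_def)
    qed
    then show "A (n * l) = carrier ?T" using I(3) by (auto simp: A_def tuples_nth_closed)
  next
    fix q assume q: "q < n * l"
    define j i where "j = q div l" and "i = q mod l"
    have j: "j < n" using q l by (simp add: j_def less_mult_imp_div_less)
    have i: "i < l" using l by (simp add: i_def)
    have "q - j * l = i" by (simp add: i_def j_def minus_div_mult_eq_mod)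
    moreover have "j * l \<le> q" by (simp add: j_def div_times_less_eq_dividend)
    ultimately have ej: "e q j = i" "e (Suc q) j = Suc i" using i by (auto simp: e_def Suc_diff_le)
    have ek: "e (Suc q) k = e q k" if "k \<noteq> j" for k
      unfolding e_def using that l by (intro series_index_step) (auto simp: j_def)
    have st: "ideal_step (I i) (I (Suc i))" by (rule I(4)[OF i])
    show "T.module_step (A q) (A (Suc q))" unfolding T.module_step_def
    proof (intro conjI ballI subsetI)
      fix v assume v: "v \<in> A q"
      have "v k \<in> I (e (Suc q) k)" if k: "k < n" for k
      proof (cases "k = j")
        case True
        then show ?thesis using v k st ej unfolding A_def ideal_step_def by auto
      next
        case False
        then show ?thesis using v k ek unfolding A_def by auto
      qed
      then show "v \<in> A (Suc q)" using v by (auto simp: A_def)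
    next
      fix c d assume c: "c \<in> A (Suc q) - A q" and d: "d \<in> A (Suc q)"
      have cc: "c \<in> carrier ?T" "d \<in> carrier ?T" using c d by (auto simp: A_def)
      have "c j \<notin> I i"
      proof
        assume *: "c j \<in> I i"
        have "c k \<in> I (e q k)" if "k < n" for k
          using that c ej ek * by (cases "k = j") (auto simp: A_def)
        then show False using c by (auto simp: A_def)
      qed
      moreover have "c j \<in> I (Suc i)" "d j \<in> I (Suc i)" using c d j ej by (auto simp: A_def)
      ultimately obtain k0 r where r: "k0 \<in> I i" "r \<in> carrier R" "d j = k0 \<oplus> r \<otimes> c j"
        using st unfolding ideal_step_def by blast
      have k0: "k0 \<in> carrier R" using ideal.Icarr[OF I(1)[of i] r(1)] i by simp
      let ?k = "d \<ominus>\<^bsub>?T\<^esub> r \<odot>\<^bsub>?T\<^esub> c"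
      have kS: "?k \<in> A (Suc q)" using c d r(2) by (intro T.sub_minus[OF sub] T.sub_smult[OF sub]) auto
      have "?k j = (k0 \<oplus> r \<otimes> c j) \<ominus> r \<otimes> c j" using cc r(2,3) j
        by (simp add: tuples_minus_nth tuples_smult_nth)
      also have "\<dots> = k0" using k0 r(2) tuples_nth_closed[OF cc(1) j]
        by (simp add: minus_eq a_assoc r_neg)
      finally have "?k j \<in> I i" using r(1) by simp
      have "?k k \<in> I (e q k)" if "k < n" for k
        using that kS ej ek \<open>?k j \<in> I i\<close> by (cases "k = j") (auto simp: A_def)
      then have "?k \<in> A q" using kS by (auto simp: A_def)
      moreover have "d = ?k \<oplus>\<^bsub>?T\<^esub> r \<odot>\<^bsub>?T\<^esub> c"
        using cc r(2) by (simp add: T.minus_add_cancel)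
      ultimately show "\<exists>k\<in>A q. \<exists>r\<in>carrier R. d = k \<oplus>\<^bsub>?T\<^esub> r \<odot>\<^bsub>?T\<^esub> c" using r(2) by blast
    qed
  qed
  then show ?thesis by blast
qed

end

section \<open>The free rank as a length\<close>

context module
begin

definition scaled :: "'a \<Rightarrow> 'c set \<Rightarrow> 'c set" where
  "scaled s X = (\<lambda>x. s \<odot>\<^bsub>M\<^esub> x) ` X"

lemma scaled_mono: "X \<subseteq> Y \<Longrightarrow> scaled s X \<subseteq> scaled s Y"
  by (auto simp: scaled_def)

lemma scaled_submodule:
  assumes X: "submodule R X M" and s: "s \<in> carrier R"
  shows "submodule R (scaled s X) M"
proof (rule submodI)
  note c = sub_carrier[OF X]
  show "scaled s X \<subseteq> carrier M" using c s by (auto simp: scaled_def)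
  show "\<zero>\<^bsub>M\<^esub> \<in> scaled s X" unfolding scaled_def
    using sub_zero[OF X] s by (intro image_eqI[of _ _ "\<zero>\<^bsub>M\<^esub>"]) auto
  show "y \<oplus>\<^bsub>M\<^esub> z \<in> scaled s X" if yz: "y \<in> scaled s X" "z \<in> scaled s X" for y z
  proof -
    obtain y' z' where "y' \<in> X" "y = s \<odot>\<^bsub>M\<^esub> y'" "z' \<in> X" "z = s \<odot>\<^bsub>M\<^esub> z'"
      using yz unfolding scaled_def by blast
    then show ?thesis unfolding scaled_def using s c sub_add[OF X]
      by (intro image_eqI[of _ _ "y' \<oplus>\<^bsub>M\<^esub> z'"]) (auto simp: smult_r_distr)
  qed
  show "r \<odot>\<^bsub>M\<^esub> y \<in> scaled s X" if r: "r \<in> carrier R" and y: "y \<in> scaled s X" for r y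
  proof -
    obtain y' where "y' \<in> X" "y = s \<odot>\<^bsub>M\<^esub> y'" using y unfolding scaled_def by blast
    then show ?thesis unfolding scaled_def using s c r sub_smult[OF X]
      by (intro image_eqI[of _ _ "r \<odot>\<^bsub>M\<^esub> y'"]) (auto simp: smult_swap)
  qed
qed

lemma restrict_submodule:
  assumes D: "submodule R D M" and F: "submodule R F M" and FD: "F \<subseteq> D"
  shows "submodule R F (M\<lparr>carrier := D\<rparr>)"
  using submodule_is_module[OF D] F FD by (simp add: submodule_def)

lemma hom_zero:
  assumes N: "module R N" and f: "f \<in> module_hom R N M"
  shows "f \<zero>\<^bsub>N\<^esub> = \<zero>\<^bsub>M\<^esub>"
proof -
  interpret N: module R N by (rule N)
  have "f \<zero>\<^bsub>N\<^esub> \<in> carrier M" using module_hom_closed[OF f] by auto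
  moreover have "f (\<zero> \<odot>\<^bsub>N\<^esub> \<zero>\<^bsub>N\<^esub>) = \<zero> \<odot>\<^bsub>M\<^esub> f \<zero>\<^bsub>N\<^esub>" by (rule module_hom_smult[OF f]) auto
  ultimately show ?thesis by simp
qed

lemma hom_image_submodule:
  assumes N: "module R N" and f: "f \<in> module_hom R N M" and U: "submodule R U N"
  shows "submodule R (f ` U) M"
proof (rule submodI)
  interpret N: module R N by (rule N)
  note c = N.sub_carrier[OF U]
  show "f ` U \<subseteq> carrier M" using module_hom_closed[OF f] c by auto
  show "\<zero>\<^bsub>M\<^esub> \<in> f ` U" using hom_zero[OF N f] N.sub_zero[OF U] by (metis image_eqI)
  show "y \<oplus>\<^bsub>M\<^esub> z \<in> f ` U" if yz: "y \<in> f ` U" "z \<in> f ` U" for y z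
  proof -
    obtain y' z' where *: "y' \<in> U" "y = f y'" "z' \<in> U" "z = f z'" using yz by blast
    then have "y \<oplus>\<^bsub>M\<^esub> z = f (y' \<oplus>\<^bsub>N\<^esub> z')" using module_hom_add[OF f] c by simp
    then show ?thesis using * N.sub_add[OF U] by blast
  qed
  show "r \<odot>\<^bsub>M\<^esub> y \<in> f ` U" if r: "r \<in> carrier R" and y: "y \<in> f ` U" for r y
  proof -
    obtain y' where *: "y' \<in> U" "y = f y'" using y by blast
    then have "r \<odot>\<^bsub>M\<^esub> y = f (r \<odot>\<^bsub>N\<^esub> y')" using module_hom_smult[OF f] c r by simp
    then show ?thesis using * N.sub_smult[OF U r] by blast
  qed
qed

end

text \<open>Stated for an arbitrary module and not in its locale, so that it applies to several modules of
  tuples at once.\<close>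

lemma carrier_sub:
  assumes "module R N" shows "submodule R (carrier N) N"
proof -
  interpret N: module R N by (rule assms)
  show ?thesis by (rule N.submodI) auto
qed

context finite_length_module
begin

text \<open>The unit vectors \<open>e\<^sub>j\<close> provide the chain of submodules \<open>s f \<langle>e\<^sub>0, ..., e\<^sub>j\<rangle>\<close> from zero up. Each
  of them is enlarged by \<open>s f(e\<^sub>j)\<close>, which is annihilated by \<open>\<mm>\<close> and which is new: applying the
  inverse of \<open>f\<close> and looking at the coordinate \<open>j\<close> would otherwise yield \<open>s = 0\<close>.\<close>

lemma len_scaled_free:
  assumes s: "s \<in> carrier R" "s \<noteq> \<zero>" "\<forall>a\<in>\<mm>. a \<otimes> s = \<zero>"
    and f: "f \<in> module_hom R (tuples R k) M" and inj: "inj_on f (carrier (tuples R k))"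
  shows "len (scaled s (f ` carrier (tuples R k))) = k"
proof -
  let ?T = "tuples R k"
  interpret T: module R ?T by (rule tuples_module)
  \<comment> \<open>The span of the first \<open>j\<close> unit vectors.\<close>
  define U where "U j = {v \<in> carrier ?T. \<forall>i<k. j \<le> i \<longrightarrow> v i = \<zero>}" for j
  have fc: "f v \<in> carrier M" if "v \<in> carrier ?T" for v using module_hom_closed[OF f] that by auto
  have U: "submodule R (U j) ?T" for j
    by (rule T.submodI) (auto simp: U_def tuples_add_nth tuples_smult_nth tuples_zero_nth)
  have fU: "submodule R (f ` U j) M" for j by (rule hom_image_submodule[OF T.module_axioms f U])
  have sfU: "submodule R (scaled s (f ` U j)) M" for j by (rule scaled_submodule[OF fU s(1)])
  have "len (scaled s (f ` U j)) = j" if "j \<le> k" for j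
    using that
  proof (induction j)
    case 0
    have "v = \<zero>\<^bsub>?T\<^esub>" if "v \<in> U 0" for v
      using that by (intro tuples_eqI) (auto simp: U_def tuples_zero_nth)
    then have "U 0 = {\<zero>\<^bsub>?T\<^esub>}" using T.sub_zero[OF U] by blast
    then have "scaled s (f ` U 0) = {\<zero>\<^bsub>M\<^esub>}" using hom_zero[OF T.module_axioms f] s(1) by (simp add: scaled_def)
    then show ?case by (simp add: len_zero)
  next
    case (Suc j)
    define e where "e = tuple_at k j \<one>"
    have e: "e \<in> carrier ?T" unfolding e_def by (rule tuple_at_carrier) simp
    have en: "e i = (if i = j then \<one> else \<zero>)" if "i < k" for i
      using that by (simp add: e_def tuple_at_nth)
    let ?x = "s \<odot>\<^bsub>M\<^esub> f e"
    have jk: "j < k" using Suc.prems by simp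
    have xc: "?x \<in> carrier M" using s(1) fc[OF e] by simp
    have m: "\<forall>a\<in>\<mm>. a \<odot>\<^bsub>M\<^esub> ?x \<in> scaled s (f ` U j)"
    proof
      fix a assume a: "a \<in> \<mm>"
      have "a \<odot>\<^bsub>M\<^esub> ?x = (a \<otimes> s) \<odot>\<^bsub>M\<^esub> f e" using max_carr[OF a] s(1) fc[OF e] by (simp add: smult_assoc1)
      also have "\<dots> = \<zero>\<^bsub>M\<^esub>" using a s(3) fc[OF e] by simp
      finally show "a \<odot>\<^bsub>M\<^esub> ?x \<in> scaled s (f ` U j)" using sub_zero[OF sfU] by simp
    qed
    have notin: "?x \<notin> scaled s (f ` U j)"
    proof
      assume "?x \<in> scaled s (f ` U j)"
      then obtain v where v: "v \<in> U j" "?x = s \<odot>\<^bsub>M\<^esub> f v" unfolding scaled_def by blast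
      have vc: "v \<in> carrier ?T" using v by (simp add: U_def)
      have "f (s \<odot>\<^bsub>?T\<^esub> e) = f (s \<odot>\<^bsub>?T\<^esub> v)" using v(2) module_hom_smult[OF f s(1)] e vc by simp
      then have "s \<odot>\<^bsub>?T\<^esub> e = s \<odot>\<^bsub>?T\<^esub> v" using inj e vc s(1) by (auto dest: inj_onD)
      then have "s \<otimes> e j = s \<otimes> v j" using tuples_smult_nth[OF jk] by metis
      moreover have "v j = \<zero>" using v(1) jk by (simp add: U_def)
      ultimately show False using en[OF jk] s by simp
    qed
    have "scaled s (f ` U (Suc j)) = adjoin (scaled s (f ` U j)) ?x"
    proof (rule antisym)
      show "adjoin (scaled s (f ` U j)) ?x \<subseteq> scaled s (f ` U (Suc j))"
      proof (rule adjoin_least[OF sfU])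
        show "scaled s (f ` U j) \<subseteq> scaled s (f ` U (Suc j))"
          by (intro scaled_mono image_mono) (auto simp: U_def)
        have "e \<in> U (Suc j)" using e en by (simp add: U_def)
        then show "?x \<in> scaled s (f ` U (Suc j))" by (auto simp: scaled_def)
      qed
      show "scaled s (f ` U (Suc j)) \<subseteq> adjoin (scaled s (f ` U j)) ?x"
      proof
        fix z assume "z \<in> scaled s (f ` U (Suc j))"
        then obtain v where v: "v \<in> U (Suc j)" "z = s \<odot>\<^bsub>M\<^esub> f v" unfolding scaled_def by blast
        have vc: "v \<in> carrier ?T" using v by (simp add: U_def)
        have vj: "v j \<in> carrier R" using vc jk by (rule tuples_nth_closed)
        define v' where "v' = (\<lambda>i\<in>{..<k}. if i = j then \<zero> else v i)"
        have v'c: "v' \<in> carrier ?T" unfolding v'_def using vc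
          by (intro tuples_restrictI) (simp add: tuples_nth_closed)
        have v'U: "v' \<in> U j" using v v'c by (auto simp: U_def v'_def)
        have "v = v' \<oplus>\<^bsub>?T\<^esub> v j \<odot>\<^bsub>?T\<^esub> e"
          using v'c e vj vc
          by (intro tuples_eqI) (auto simp: tuples_add_nth tuples_smult_nth en v'_def tuples_nth_closed)
        then have "f v = f (v' \<oplus>\<^bsub>?T\<^esub> v j \<odot>\<^bsub>?T\<^esub> e)" by (rule arg_cong)
        also have "\<dots> = f v' \<oplus>\<^bsub>M\<^esub> v j \<odot>\<^bsub>M\<^esub> f e"
          using module_hom_add[OF f] module_hom_smult[OF f] v'c e vj by simp
        finally have "z = s \<odot>\<^bsub>M\<^esub> f v' \<oplus>\<^bsub>M\<^esub> v j \<odot>\<^bsub>M\<^esub> ?x"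
          using v(2) s(1) vj fc[OF e] fc[OF v'c] by (simp add: smult_r_distr smult_swap)
        moreover have "s \<odot>\<^bsub>M\<^esub> f v' \<in> scaled s (f ` U j)" using v'U by (auto simp: scaled_def)
        ultimately show "z \<in> adjoin (scaled s (f ` U j)) ?x" using vj adjoinI by blast
      qed
    qed
    then show ?case using len_adjoin[OF sfU xc notin m] Suc by simp
  qed
  moreover have "U k = carrier ?T" by (auto simp: U_def)
  ultimately show ?thesis by (metis order_refl)
qed

end

text \<open>The space \<open>R^n\<close> that contains the codes, with a fixed composition series.\<close>

locale ambient_space = finite_length_module R \<mm> "tuples R n" A l
  for R (structure) and \<mm> and n and A and l
begin

abbreviation T where "T \<equiv> tuples R n"

text \<open>By induction on \<open>k\<close>, splitting off one free generator at a time. If \<open>s d \<noteq> 0\<close>, then \<open>d\<close> has a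
  coordinate outside \<open>\<mm>\<close>; a multiple \<open>\<phi>\<close> of that coordinate is a linear form with \<open>\<phi> d = 1\<close>,
  so \<open>D\<close> is the direct sum of \<open>R d\<close> and the kernel \<open>D'\<close> of \<open>\<phi>\<close> on \<open>D\<close>. The submodule \<open>s D\<close> is
  \<open>s D'\<close> enlarged by \<open>s d\<close>, so \<open>s D'\<close> is shorter by one.\<close>

lemma free_summand_exists:
  assumes s: "s \<in> carrier R" "s \<noteq> \<zero>" "\<forall>a\<in>\<mm>. a \<otimes> s = \<zero>"
  shows "\<lbrakk>submodule R D T; len (scaled s D) = k\<rbrakk> \<Longrightarrow>
    \<exists>f N. f \<in> module_hom R (tuples R k) T \<and> inj_on f (carrier (tuples R k)) \<and>
      f ` carrier (tuples R k) \<subseteq> D \<and> submodule R N T \<and> N \<subseteq> D \<and>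
      f ` carrier (tuples R k) \<inter> N = {\<zero>\<^bsub>T\<^esub>} \<and>
      (\<forall>d\<in>D. \<exists>v\<in>carrier (tuples R k). \<exists>y\<in>N. d = f v \<oplus>\<^bsub>T\<^esub> y)"
proof (induction k arbitrary: D)
  case (0 D)
  note D = 0(1)
  have c0: "carrier (tuples R 0) = {\<lambda>_. undefined}" using tuples_carrier[of 0] by simp
  let ?f = "\<lambda>_::nat \<Rightarrow> 'a. \<zero>\<^bsub>T\<^esub>"
  have "?f \<in> module_hom R (tuples R 0) T" by (simp add: module_hom_def)
  moreover have "d = ?f v \<oplus>\<^bsub>T\<^esub> d" if "d \<in> D" for d and v :: "nat \<Rightarrow> 'a"
    using that sub_carrier[OF D] by simp
  ultimately show ?case using D sub_zero[OF D] unfolding c0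
    by (intro exI[of _ ?f] exI[of _ D]) auto
next
  case (Suc k D)
  note D = Suc.prems(1)
  note c = sub_carrier[OF D]
  have "\<exists>d\<in>D. s \<odot>\<^bsub>T\<^esub> d \<noteq> \<zero>\<^bsub>T\<^esub>"
  proof (rule ccontr)
    assume "\<not> ?thesis"
    then have "scaled s D \<subseteq> {\<zero>\<^bsub>T\<^esub>}" by (auto simp: scaled_def)
    from len_mono[OF this] show False using Suc.prems(2) by (simp add: len_zero)
  qed
  then obtain d where d: "d \<in> D" "s \<odot>\<^bsub>T\<^esub> d \<noteq> \<zero>\<^bsub>T\<^esub>" by blast
  have "\<exists>i<n. s \<otimes> d i \<noteq> \<zero>"
  proof (rule ccontr)
    assume "\<not> ?thesis"
    then have "s \<odot>\<^bsub>T\<^esub> d = \<zero>\<^bsub>T\<^esub>" using s(1) c[OF d(1)]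
      by (intro tuples_eqI) (auto simp: tuples_smult_nth tuples_zero_nth)
    then show False using d(2) by simp
  qed
  then obtain i where i: "i < n" "s \<otimes> d i \<noteq> \<zero>" by blast
  have di: "d i \<in> carrier R" using c[OF d(1)] i(1) by (rule tuples_nth_closed)
  have "d i \<notin> \<mm>" using i(2) s(1,3) di by (auto simp: R.m_comm)
  from unit_outside_max[OF di this] obtain u where u: "u \<in> carrier R" "u \<otimes> d i = \<one>" by blast
  define \<phi> where "\<phi> y = u \<otimes> y i" for y :: "nat \<Rightarrow> 'a"
  have \<phi>c: "\<phi> y \<in> carrier R" if "y \<in> carrier T" for y
    using u(1) tuples_nth_closed[OF that i(1)] by (simp add: \<phi>_def)
  have \<phi>d: "\<phi> d = \<one>" using u by (simp add: \<phi>_def)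
  have \<phi>_add: "\<phi> (x \<oplus>\<^bsub>T\<^esub> y) = \<phi> x \<oplus> \<phi> y" if "x \<in> carrier T" "y \<in> carrier T" for x y
    using u(1) that i(1) by (simp add: \<phi>_def tuples_add_nth r_distr tuples_nth_closed)
  have \<phi>_smult: "\<phi> (r \<odot>\<^bsub>T\<^esub> x) = r \<otimes> \<phi> x" if "r \<in> carrier R" "x \<in> carrier T" for r x
    using u(1) that i(1) by (simp add: \<phi>_def tuples_smult_nth R.m_lcomm tuples_nth_closed)
  have \<phi>_zero: "\<phi> \<zero>\<^bsub>T\<^esub> = \<zero>" using u(1) i(1) by (simp add: \<phi>_def tuples_zero_nth)
  define D' where "D' = {y \<in> D. \<phi> y = \<zero>}"
  have D': "submodule R D' T"
  proof (rule submodI)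
    show "D' \<subseteq> carrier T" using c by (auto simp: D'_def)
    show "\<zero>\<^bsub>T\<^esub> \<in> D'" using sub_zero[OF D] \<phi>_zero by (simp add: D'_def)
    show "x \<oplus>\<^bsub>T\<^esub> y \<in> D'" if "x \<in> D'" "y \<in> D'" for x y
      using that c sub_add[OF D] by (simp add: D'_def \<phi>_add)
    show "r \<odot>\<^bsub>T\<^esub> x \<in> D'" if "r \<in> carrier R" "x \<in> D'" for r x
      using that c sub_smult[OF D] by (simp add: D'_def \<phi>_smult)
  qed
  have split: "\<exists>y\<in>D'. x = y \<oplus>\<^bsub>T\<^esub> \<phi> x \<odot>\<^bsub>T\<^esub> d" if x: "x \<in> D" for x
  proof -
    have xc: "x \<in> carrier T" "d \<in> carrier T" using x d c by auto
    let ?y = "x \<ominus>\<^bsub>T\<^esub> \<phi> x \<odot>\<^bsub>T\<^esub> d"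
    have e: "x = ?y \<oplus>\<^bsub>T\<^esub> \<phi> x \<odot>\<^bsub>T\<^esub> d" using xc \<phi>c[OF xc(1)] by (simp add: minus_add_cancel)
    have yc: "?y \<in> carrier T" using xc \<phi>c[OF xc(1)] by simp
    have "\<phi> x = \<phi> ?y \<oplus> \<phi> x" using arg_cong[OF e, of \<phi>] xc \<phi>c[OF xc(1)] yc
      by (simp add: \<phi>_add \<phi>_smult \<phi>d)
    then have "\<phi> ?y = \<zero>" using \<phi>c[OF xc(1)] \<phi>c[OF yc] by (metis R.add.r_cancel_one' R.add.l_cancel_one R.a_comm)
    moreover have "?y \<in> D" using x d(1) \<phi>c[OF xc(1)] by (intro sub_minus[OF D] sub_smult[OF D]) auto
    ultimately show ?thesis using e by (auto simp: D'_def)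
  qed
  note c' = sub_carrier[OF D']
  have sD': "submodule R (scaled s D') T" by (rule scaled_submodule[OF D' s(1)])
  have dc: "d \<in> carrier T" using c d by simp
  have xc: "s \<odot>\<^bsub>T\<^esub> d \<in> carrier T" using s(1) dc by simp
  have "scaled s D = adjoin (scaled s D') (s \<odot>\<^bsub>T\<^esub> d)"
  proof (rule antisym)
    show "adjoin (scaled s D') (s \<odot>\<^bsub>T\<^esub> d) \<subseteq> scaled s D"
      using d(1) by (intro adjoin_least[OF scaled_submodule[OF D s(1)]] scaled_mono) (auto simp: D'_def scaled_def)
    show "scaled s D \<subseteq> adjoin (scaled s D') (s \<odot>\<^bsub>T\<^esub> d)"
    proof
      fix z assume "z \<in> scaled s D"
      then obtain x where x: "x \<in> D" "z = s \<odot>\<^bsub>T\<^esub> x" unfolding scaled_def by blast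
      obtain y where y: "y \<in> D'" "x = y \<oplus>\<^bsub>T\<^esub> \<phi> x \<odot>\<^bsub>T\<^esub> d" using split[OF x(1)] by blast
      have px: "\<phi> x \<in> carrier R" using \<phi>c c x(1) by simp
      have "z = s \<odot>\<^bsub>T\<^esub> (y \<oplus>\<^bsub>T\<^esub> \<phi> x \<odot>\<^bsub>T\<^esub> d)" using x(2) y(2) by simp
      also have "\<dots> = s \<odot>\<^bsub>T\<^esub> y \<oplus>\<^bsub>T\<^esub> \<phi> x \<odot>\<^bsub>T\<^esub> (s \<odot>\<^bsub>T\<^esub> d)"
        using s(1) px dc c'[OF y(1)] by (simp add: smult_r_distr smult_swap)
      finally show "z \<in> adjoin (scaled s D') (s \<odot>\<^bsub>T\<^esub> d)"
        using adjoinI[of "s \<odot>\<^bsub>T\<^esub> y" "scaled s D'" "\<phi> x" "s \<odot>\<^bsub>T\<^esub> d"] px y(1) by (simp add: scaled_def)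
    qed
  qed
  moreover have "s \<odot>\<^bsub>T\<^esub> d \<notin> scaled s D'"
  proof
    assume "s \<odot>\<^bsub>T\<^esub> d \<in> scaled s D'"
    then obtain y where y: "y \<in> D'" "s \<odot>\<^bsub>T\<^esub> d = s \<odot>\<^bsub>T\<^esub> y" unfolding scaled_def by blast
    have "s = \<phi> (s \<odot>\<^bsub>T\<^esub> d)" using s(1) dc \<phi>d by (simp add: \<phi>_smult)
    also have "\<dots> = \<zero>" using y s(1) c' by (simp add: \<phi>_smult D'_def)
    finally show False using s(2) by simp
  qed
  moreover have "\<forall>a\<in>\<mm>. a \<odot>\<^bsub>T\<^esub> (s \<odot>\<^bsub>T\<^esub> d) \<in> scaled s D'"
  proof
    fix a assume a: "a \<in> \<mm>"
    have "a \<odot>\<^bsub>T\<^esub> (s \<odot>\<^bsub>T\<^esub> d) = (a \<otimes> s) \<odot>\<^bsub>T\<^esub> d" using max_carr[OF a] s(1) dc by (simp add: smult_assoc1)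
    also have "\<dots> = \<zero>\<^bsub>T\<^esub>" using a s(3) dc by simp
    finally show "a \<odot>\<^bsub>T\<^esub> (s \<odot>\<^bsub>T\<^esub> d) \<in> scaled s D'" using sub_zero[OF sD'] by simp
  qed
  ultimately have "len (scaled s D') = k" using len_adjoin[OF sD' xc] Suc.prems(2) by simp
  from Suc.IH[OF D' this] obtain g N where g: "g \<in> module_hom R (tuples R k) T"
    "inj_on g (carrier (tuples R k))" "g ` carrier (tuples R k) \<subseteq> D'"
    and N: "submodule R N T" "N \<subseteq> D'" "g ` carrier (tuples R k) \<inter> N = {\<zero>\<^bsub>T\<^esub>}"
      "\<forall>d\<in>D'. \<exists>v\<in>carrier (tuples R k). \<exists>y\<in>N. d = g v \<oplus>\<^bsub>T\<^esub> y" by blast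
  define res where "res v = restrict v {..<k}" for v :: "nat \<Rightarrow> 'a"
  \<comment> \<open>The last coordinate of \<open>v\<close> is the coefficient of the new generator \<open>d\<close>.\<close>
  define f where "f v = g (res v) \<oplus>\<^bsub>T\<^esub> v k \<odot>\<^bsub>T\<^esub> d" for v
  let ?K = "tuples R (Suc k)"
  have res: "res v \<in> carrier (tuples R k)" if "v \<in> carrier ?K" for v
    unfolding res_def using that by (intro tuples_restrictI) (simp add: tuples_nth_closed)
  have vk: "v k \<in> carrier R" if "v \<in> carrier ?K" for v using that by (simp add: tuples_nth_closed)
  have gD': "g (res v) \<in> D'" if "v \<in> carrier ?K" for v using g(3) res[OF that] by blast
  have gc: "g (res v) \<in> carrier T" if "v \<in> carrier ?K" for v using c' gD'[OF that] by blast
  have \<phi>f: "\<phi> (f v) = v k" if "v \<in> carrier ?K" for v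
    using gD'[OF that] gc[OF that] vk[OF that] dc by (simp add: f_def \<phi>_add \<phi>_smult \<phi>d D'_def)
  have f_hom: "f \<in> module_hom R ?K T"
  proof -
    have "f v \<in> carrier T" if "v \<in> carrier ?K" for v
      using gc[OF that] vk[OF that] dc by (simp add: f_def)
    moreover have "f (v \<oplus>\<^bsub>?K\<^esub> w) = f v \<oplus>\<^bsub>T\<^esub> f w" if v: "v \<in> carrier ?K" and w: "w \<in> carrier ?K" for v w
    proof -
      have "res (v \<oplus>\<^bsub>?K\<^esub> w) = res v \<oplus>\<^bsub>tuples R k\<^esub> res w"
        by (auto simp: res_def func_space_def restrict_def)
      then show ?thesis using module_hom_add[OF g(1) res[OF v] res[OF w]] gc v w vk dc
        by (simp add: f_def tuples_add_nth smult_l_distr M.a_ac)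
    qed
    moreover have "f (r \<odot>\<^bsub>?K\<^esub> v) = r \<odot>\<^bsub>T\<^esub> f v" if r: "r \<in> carrier R" and v: "v \<in> carrier ?K" for r v
    proof -
      have "res (r \<odot>\<^bsub>?K\<^esub> v) = r \<odot>\<^bsub>tuples R k\<^esub> res v"
        by (auto simp: res_def func_space_def restrict_def)
      then show ?thesis using module_hom_smult[OF g(1) r res[OF v]] gc v r vk dc
        by (simp add: f_def tuples_smult_nth smult_r_distr smult_assoc1)
    qed
    ultimately show ?thesis by (simp add: module_hom_def)
  qed
  have f_inj: "inj_on f (carrier ?K)"
  proof (rule inj_onI)
    fix v w assume v: "v \<in> carrier ?K" and w: "w \<in> carrier ?K" and eq: "f v = f w"
    have k: "v k = w k" using \<phi>f[OF v] \<phi>f[OF w] eq by simp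
    then have "g (res v) = g (res w)" using eq gc[OF v] gc[OF w] vk[OF w] dc
      by (simp add: f_def)
    then have r: "res v = res w" using g(2) res[OF v] res[OF w] by (auto dest: inj_onD)
    show "v = w"
    proof (rule tuples_eqI[OF v w])
      fix i assume "i < Suc k"
      then show "v i = w i" using k fun_cong[OF r, of i] by (cases "i = k") (auto simp: res_def)
    qed
  qed
  have f_D: "f ` carrier ?K \<subseteq> D"
    using gD' vk d(1) by (auto simp: f_def D'_def intro!: sub_add[OF D] sub_smult[OF D])
  have f_N: "f ` carrier ?K \<inter> N = {\<zero>\<^bsub>T\<^esub>}"
  proof (rule antisym)
    show "f ` carrier ?K \<inter> N \<subseteq> {\<zero>\<^bsub>T\<^esub>}"
    proof
      fix z assume z: "z \<in> f ` carrier ?K \<inter> N"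
      then obtain v where v: "v \<in> carrier ?K" "z = f v" by blast
      have "\<phi> z = \<zero>" using z N(2) by (auto simp: D'_def)
      then have "v k = \<zero>" using \<phi>f[OF v(1)] v(2) by simp
      then have "z = g (res v)" using v gc[OF v(1)] dc by (simp add: f_def)
      then show "z \<in> {\<zero>\<^bsub>T\<^esub>}" using z N(3) res[OF v(1)] by blast
    qed
    have K: "module R ?K" by (rule tuples_module)
    have "\<zero>\<^bsub>T\<^esub> \<in> f ` carrier ?K"
      by (rule sub_zero[OF hom_image_submodule[OF K f_hom carrier_sub[OF K]]])
    then show "{\<zero>\<^bsub>T\<^esub>} \<subseteq> f ` carrier ?K \<inter> N" using sub_zero[OF N(1)] by simp
  qed
  have decomp: "\<exists>v\<in>carrier ?K. \<exists>y\<in>N. x = f v \<oplus>\<^bsub>T\<^esub> y" if x: "x \<in> D" for x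
  proof -
    obtain x' where x': "x' \<in> D'" "x = x' \<oplus>\<^bsub>T\<^esub> \<phi> x \<odot>\<^bsub>T\<^esub> d" using split[OF x] by blast
    obtain v y where v: "v \<in> carrier (tuples R k)" and y: "y \<in> N" and e: "x' = g v \<oplus>\<^bsub>T\<^esub> y"
      using N(4) x'(1) by blast
    have px: "\<phi> x \<in> carrier R" using \<phi>c c x by simp
    define v' where "v' = (\<lambda>i\<in>{..<Suc k}. if i = k then \<phi> x else v i)"
    have v': "v' \<in> carrier ?K" unfolding v'_def using px v
      by (intro tuples_restrictI) (auto simp: less_Suc_eq intro: tuples_nth_closed)
    have "res v' = v" by (rule tuples_eqI[OF res[OF v'] v]) (simp add: res_def v'_def)
    then have "f v' = g v \<oplus>\<^bsub>T\<^esub> \<phi> x \<odot>\<^bsub>T\<^esub> d" by (simp add: f_def v'_def)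
    moreover have "g v \<in> carrier T" using g(3) v c' by blast
    moreover have "y \<in> carrier T" using y N(1) sub_carrier by blast
    ultimately have "x = f v' \<oplus>\<^bsub>T\<^esub> y" using x'(2) px dc unfolding e by (simp add: M.a_ac)
    then show ?thesis using v' y by blast
  qed
  have "N \<subseteq> D" using N(2) by (auto simp: D'_def)
  then show ?case
    by (intro exI[of _ f] exI[of _ N] conjI ballI f_hom f_inj f_D f_N decomp N(1))
qed

text \<open>A free submodule \<open>F\<close> of \<open>D\<close> of rank \<open>k\<close> has \<open>k = len (s F) \<le> len (s D)\<close>, and this bound is
  attained by a direct summand.\<close>

lemma free_rank_eq_len:
  assumes s: "s \<in> carrier R" "s \<noteq> \<zero>" "\<forall>a\<in>\<mm>. a \<otimes> s = \<zero>"
    and D: "submodule R D T"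
  shows "free_rank R (T\<lparr>carrier := D\<rparr>) = len (scaled s D)"
proof -
  let ?S = "{k. \<exists>F. direct_summand R F (T\<lparr>carrier := D\<rparr>) \<and> module_iso R (tuples R k) (T\<lparr>carrier := D, carrier := F\<rparr>)}"
  have le: "k \<le> len (scaled s D)" if "k \<in> ?S" for k
  proof -
    obtain F f where F: "direct_summand R F (T\<lparr>carrier := D\<rparr>)"
      and f: "f \<in> module_hom R (tuples R k) (T\<lparr>carrier := D, carrier := F\<rparr>)" "bij_betw f (carrier (tuples R k)) F"
      using \<open>k \<in> ?S\<close> unfolding module_iso_def by auto
    have FD: "F \<subseteq> D" using F unfolding direct_summand_def submodule_def by simp
    then have "f \<in> module_hom R (tuples R k) T"
      using f(1) sub_carrier[OF D] by (auto simp: module_hom_def)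
    from len_scaled_free[OF s this] have "len (scaled s F) = k" using f(2) by (simp add: bij_betw_def)
    then show ?thesis using len_mono[OF scaled_mono[OF FD]] by metis
  qed
  obtain f N where f: "f \<in> module_hom R (tuples R (len (scaled s D))) T"
      "inj_on f (carrier (tuples R (len (scaled s D))))"
      "f ` carrier (tuples R (len (scaled s D))) \<subseteq> D"
    and N: "submodule R N T" "N \<subseteq> D" "f ` carrier (tuples R (len (scaled s D))) \<inter> N = {\<zero>\<^bsub>T\<^esub>}"
      "\<forall>d\<in>D. \<exists>v\<in>carrier (tuples R (len (scaled s D))). \<exists>y\<in>N. d = f v \<oplus>\<^bsub>T\<^esub> y"
    using free_summand_exists[OF s D refl] by blast
  let ?F = "f ` carrier (tuples R (len (scaled s D)))"
  have F: "submodule R ?F T"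
    by (rule hom_image_submodule[OF tuples_module f(1) carrier_sub[OF tuples_module]])
  interpret D: module R "T\<lparr>carrier := D\<rparr>" by (rule submodule_is_module[OF D])
  have "D.submodule_sum ?F N = D"
  proof (rule antisym)
    show "D.submodule_sum ?F N \<subseteq> D" unfolding D.submodule_sum_def using f(3) N(2) sub_add[OF D] by auto
    show "D \<subseteq> D.submodule_sum ?F N"
    proof
      fix d assume "d \<in> D"
      then obtain v y where "v \<in> carrier (tuples R (len (scaled s D)))" "y \<in> N" "d = f v \<oplus>\<^bsub>T\<^esub> y" using N(4) by blast
      then show "d \<in> D.submodule_sum ?F N" unfolding D.submodule_sum_def
        by (intro image_eqI[of _ _ "(f v, y)"]) auto
    qed
  qed
  then have "direct_summand R ?F (T\<lparr>carrier := D\<rparr>)" unfolding direct_summand_def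
    using restrict_submodule[OF D F f(3)] restrict_submodule[OF D N(1,2)] N(3) by auto
  moreover have "f \<in> module_hom R (tuples R (len (scaled s D))) (T\<lparr>carrier := D, carrier := ?F\<rparr>)"
    using f(1) by (auto simp: module_hom_def)
  then have "module_iso R (tuples R (len (scaled s D))) (T\<lparr>carrier := D, carrier := ?F\<rparr>)"
    unfolding module_iso_def using f(2) by (auto simp: bij_betw_def)
  ultimately have mem: "len (scaled s D) \<in> ?S" by blast
  show ?thesis unfolding free_rank_def
  proof (rule Max_eqI)
    show "finite ?S" by (rule finite_subset[of _ "{..len (scaled s D)}"]) (use le in auto)
  qed (use le mem in auto)
qed

end

section \<open>The type as a length\<close>

context local_module
begin

abbreviation K where "K \<equiv> R Quot \<mm>"

lemma residue_field: "field K"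
  by (rule maxi.quotient_is_field) (rule R.is_cring)

lemma residueE:
  assumes "X \<in> carrier K"
  obtains r where "r \<in> carrier R" "X = \<mm> +>\<^bsub>R\<^esub> r"
  using assms unfolding FactRing_def A_RCOSETS_def' by auto

lemma residueI: "r \<in> carrier R \<Longrightarrow> \<mm> +>\<^bsub>R\<^esub> r \<in> carrier K"
  unfolding FactRing_def A_RCOSETS_def' by auto

lemma residue_add: "\<lbrakk>r \<in> carrier R; t \<in> carrier R\<rbrakk> \<Longrightarrow>
    (\<mm> +>\<^bsub>R\<^esub> r) \<oplus>\<^bsub>K\<^esub> (\<mm> +>\<^bsub>R\<^esub> t) = \<mm> +>\<^bsub>R\<^esub> (r \<oplus> t)"
  using ring_hom_add[OF maxi.rcos_ring_hom, of r t] by simp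

lemma residue_mult: "\<lbrakk>r \<in> carrier R; t \<in> carrier R\<rbrakk> \<Longrightarrow>
    (\<mm> +>\<^bsub>R\<^esub> r) \<otimes>\<^bsub>K\<^esub> (\<mm> +>\<^bsub>R\<^esub> t) = \<mm> +>\<^bsub>R\<^esub> (r \<otimes> t)"
  using ring_hom_mult[OF maxi.rcos_ring_hom, of r t] by simp

lemma residue_one: "\<one>\<^bsub>K\<^esub> = \<mm> +>\<^bsub>R\<^esub> \<one>"
  using ring_hom_one[OF maxi.rcos_ring_hom] by simp

abbreviation soc :: "'c set \<Rightarrow> 'c set" where
  "soc C \<equiv> socle \<mm> (M\<lparr>carrier := C\<rparr>)"

lemma soc_iff: "v \<in> soc C \<longleftrightarrow> v \<in> C \<and> (\<forall>a\<in>\<mm>. a \<odot>\<^bsub>M\<^esub> v = \<zero>\<^bsub>M\<^esub>)"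
  by (simp add: socle_def)

lemma soc_submodule:
  assumes C: "submodule R C M"
  shows "submodule R (soc C) M"
proof (rule submodI)
  note c = sub_carrier[OF C]
  show "soc C \<subseteq> carrier M" using c by (auto simp: soc_iff)
  show "\<zero>\<^bsub>M\<^esub> \<in> soc C" using sub_zero[OF C] max_carr by (auto simp: soc_iff)
  show "x \<oplus>\<^bsub>M\<^esub> y \<in> soc C" if "x \<in> soc C" "y \<in> soc C" for x y
    using that c sub_add[OF C] max_carr by (auto simp: soc_iff smult_r_distr)
  show "r \<odot>\<^bsub>M\<^esub> x \<in> soc C" if "r \<in> carrier R" "x \<in> soc C" for r x
  proof -
    have "a \<odot>\<^bsub>M\<^esub> (r \<odot>\<^bsub>M\<^esub> x) = r \<odot>\<^bsub>M\<^esub> (a \<odot>\<^bsub>M\<^esub> x)" if "a \<in> \<mm>" for a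
      using that \<open>r \<in> carrier R\<close> \<open>x \<in> soc C\<close> c max_carr by (simp add: soc_iff smult_swap[of a r])
    then show ?thesis using that sub_smult[OF C] by (auto simp: soc_iff)
  qed
qed

text \<open>Two representatives of a coset differ by an element of \<open>\<mm>\<close>, which kills \<open>v\<close>.\<close>

lemma residue_action:
  assumes r: "r \<in> carrier R" and v: "v \<in> carrier M" "\<forall>a\<in>\<mm>. a \<odot>\<^bsub>M\<^esub> v = \<zero>\<^bsub>M\<^esub>"
  shows "(\<lambda>r. r \<odot>\<^bsub>M\<^esub> v) ` (\<mm> +>\<^bsub>R\<^esub> r) = {r \<odot>\<^bsub>M\<^esub> v}"
proof -
  have "(h \<oplus> r) \<odot>\<^bsub>M\<^esub> v = r \<odot>\<^bsub>M\<^esub> v" if "h \<in> \<mm>" for h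
    using that r v max_carr by (simp add: smult_l_distr)
  then have "(\<lambda>r. r \<odot>\<^bsub>M\<^esub> v) ` (\<mm> +>\<^bsub>R\<^esub> r) \<subseteq> {r \<odot>\<^bsub>M\<^esub> v}"
    unfolding a_r_coset_def' by blast
  moreover have "r \<odot>\<^bsub>M\<^esub> v \<in> (\<lambda>r. r \<odot>\<^bsub>M\<^esub> v) ` (\<mm> +>\<^bsub>R\<^esub> r)"
    by (rule imageI) (rule maxi.a_rcos_self[OF r])
  ultimately show ?thesis by blast
qed

end

context finite_length_module
begin

text \<open>The socle of \<open>C\<close> is a vector space over the residue field whose subspaces are its submodules, so
  a chain from zero up to the socle yields a basis with as many elements as the chain has steps.\<close>

lemma module_type_eq_len:
  assumes C: "submodule R C M"
  shows "module_type R \<mm> (M\<lparr>carrier := C\<rparr>) = len (soc C)"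
proof -
  define V where "V = socle_space \<mm> (M\<lparr>carrier := C\<rparr>)"
  note S = soc_submodule[OF C]
  note c = sub_carrier[OF S]
  have V_carrier: "carrier V = soc C" and V_add: "\<And>v w. v \<oplus>\<^bsub>V\<^esub> w = v \<oplus>\<^bsub>M\<^esub> w"
    and V_zero: "\<zero>\<^bsub>V\<^esub> = \<zero>\<^bsub>M\<^esub>"
    by (simp_all add: V_def socle_space_def)
  have V_smult: "(\<mm> +>\<^bsub>R\<^esub> r) \<odot>\<^bsub>V\<^esub> v = r \<odot>\<^bsub>M\<^esub> v" if "r \<in> carrier R" "v \<in> soc C" for r v
    using residue_action[OF that(1) c[OF that(2)]] that(2) by (simp add: V_def socle_space_def soc_iff)
  note V = V_carrier V_add V_zero
  interpret F: field K by (rule residue_field)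
  have V_module: "module K V"
  proof (rule module_criteria)
    show "cring K" by (rule F.is_cring)
    show "\<forall>v\<in>carrier V. \<exists>w\<in>carrier V. v \<oplus>\<^bsub>V\<^esub> w = \<zero>\<^bsub>V\<^esub>"
    proof
      fix v assume v: "v \<in> carrier V"
      then have vc: "v \<in> carrier M" using c V by simp
      have "(\<ominus> \<one>) \<odot>\<^bsub>M\<^esub> v \<in> soc C" using v V by (intro sub_smult[OF S]) auto
      then have "\<ominus>\<^bsub>M\<^esub> v \<in> soc C" using vc by (simp add: smult_minus_one)
      moreover have "v \<oplus>\<^bsub>M\<^esub> \<ominus>\<^bsub>M\<^esub> v = \<zero>\<^bsub>M\<^esub>" using vc by (rule M.r_neg)
      ultimately show "\<exists>w\<in>carrier V. v \<oplus>\<^bsub>V\<^esub> w = \<zero>\<^bsub>V\<^esub>" unfolding V by blast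
    qed
    show "\<forall>a v. a \<in> carrier K \<and> v \<in> carrier V \<longrightarrow> a \<odot>\<^bsub>V\<^esub> v \<in> carrier V"
      using sub_smult[OF S] by (auto elim!: residueE simp: V V_smult)
    show "\<forall>v\<in>carrier V. \<one>\<^bsub>K\<^esub> \<odot>\<^bsub>V\<^esub> v = v"
      using c by (simp add: residue_one V V_smult)
    show "\<forall>a b v. a \<in> carrier K \<and> b \<in> carrier K \<and> v \<in> carrier V \<longrightarrow> (a \<otimes>\<^bsub>K\<^esub> b) \<odot>\<^bsub>V\<^esub> v = a \<odot>\<^bsub>V\<^esub> (b \<odot>\<^bsub>V\<^esub> v)"
      using c sub_smult[OF S] by (auto elim!: residueE simp: V V_smult residue_mult smult_assoc1)
    show "\<forall>a b v. a \<in> carrier K \<and> b \<in> carrier K \<and> v \<in> carrier V \<longrightarrow>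
      (a \<oplus>\<^bsub>K\<^esub> b) \<odot>\<^bsub>V\<^esub> v = a \<odot>\<^bsub>V\<^esub> v \<oplus>\<^bsub>V\<^esub> b \<odot>\<^bsub>V\<^esub> v"
      using c sub_smult[OF S] by (auto elim!: residueE simp: V V_smult residue_add smult_l_distr)
    show "\<forall>a v w. a \<in> carrier K \<and> v \<in> carrier V \<and> w \<in> carrier V \<longrightarrow>
      a \<odot>\<^bsub>V\<^esub> (v \<oplus>\<^bsub>V\<^esub> w) = a \<odot>\<^bsub>V\<^esub> v \<oplus>\<^bsub>V\<^esub> a \<odot>\<^bsub>V\<^esub> w"
      using c sub_add[OF S] by (auto elim!: residueE simp: V V_smult smult_r_distr)
  qed (use c sub_zero[OF S] sub_add[OF S] in \<open>auto simp: V M.a_ac\<close>)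
  interpret V: vectorspace K V
    by (intro vectorspace.intro V_module residue_field)
  have subV: "submodule K Z V" if Z: "submodule R Z M" "Z \<subseteq> soc C" for Z
  proof -
    have "a \<odot>\<^bsub>V\<^esub> z \<in> Z" if a: "a \<in> carrier K" and z: "z \<in> Z" for a z
    proof -
      obtain r where "r \<in> carrier R" "a = \<mm> +>\<^bsub>R\<^esub> r" using a by (rule residueE)
      then show ?thesis using sub_smult[OF Z(1), of r z] z Z(2) V_smult by auto
    qed
    then show ?thesis using Z sub_zero[OF Z(1)] sub_add[OF Z(1)] V_module
      by (simp add: submodule_def V)
  qed
  \<comment> \<open>The dimension is only meaningful once a finite basis is known, so the induction produces one.\<close>
  let ?P = "\<lambda>Z. \<exists>B. finite B \<and> B \<subseteq> soc C \<and> V.lin_indpt B \<and> V.span B = Z \<and> card B = len Z"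
  have zS: "{\<zero>\<^bsub>M\<^esub>} \<subseteq> soc C" using sub_zero[OF S] by simp
  have z: "submodule R {\<zero>\<^bsub>M\<^esub>} M" by (rule submodI) auto
  have "?P (soc C)"
  proof (induction rule: submodule_chain_induct[OF z S zS])
    case 1
    have "V.lin_indpt {}" by (auto simp: V.lin_dep_def)
    then show ?case using V.span_empty by (intro exI[of _ "{}"]) (auto simp: len_zero V)
  next
    case (2 Z x)
    then obtain B where B: "finite B" "B \<subseteq> soc C" "V.lin_indpt B" "V.span B = Z" "card B = len Z" by blast
    have xc: "x \<in> carrier M" using 2 c by blast
    have Bc: "B \<subseteq> carrier V" "B \<union> {x} \<subseteq> carrier V" using B 2 V by auto
    have xB: "x \<notin> B" using V.in_own_span[OF Bc(1)] B(4) 2 by blast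
    have li: "V.lin_indpt (B \<union> {x})"
      using V.lin_dep_iff_in_span[OF Bc(1) B(3) _ xB] B(4) 2 V by auto
    have sub: "submodule K (V.span (B \<union> {x})) V" by (rule V.span_is_submodule[OF Bc(2)])
    have "B \<subseteq> Z" using V.in_own_span[OF Bc(1)] B(4) by simp
    then have BZ: "B \<union> {x} \<subseteq> adjoin Z x" using adjoin_superset[OF _ xc] adjoin_self[OF _ xc] 2 by auto
    have "V.span (B \<union> {x}) = adjoin Z x"
    proof (rule antisym)
      have "submodule K (adjoin Z x) V"
        using 2 xc by (intro subV adjoin_submodule adjoin_least[OF S]) auto
      with BZ show "V.span (B \<union> {x}) \<subseteq> adjoin Z x" by (intro V.span_is_subset)
      show "adjoin Z x \<subseteq> V.span (B \<union> {x})"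
      proof
        fix y assume "y \<in> adjoin Z x"
        then obtain k r where k: "k \<in> Z" "r \<in> carrier R" "y = k \<oplus>\<^bsub>M\<^esub> r \<odot>\<^bsub>M\<^esub> x" by (rule adjoinE)
        have "k \<in> V.span (B \<union> {x})" using k(1) B(4) V.span_is_monotone[of B "B \<union> {x}"] by auto
        moreover have "x \<in> V.span (B \<union> {x})" using V.in_own_span[OF Bc(2)] by blast
        then have "(\<mm> +>\<^bsub>R\<^esub> r) \<odot>\<^bsub>V\<^esub> x \<in> V.span (B \<union> {x})"
          using submodule.smult_closed[OF sub residueI[OF k(2)]] by blast
        then have "r \<odot>\<^bsub>M\<^esub> x \<in> V.span (B \<union> {x})" using V_smult[OF k(2)] 2 by simp
        ultimately show "y \<in> V.span (B \<union> {x})"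
          using submodule.m_closed[OF sub] unfolding k(3) V by blast
      qed
    qed
    moreover have "card (B \<union> {x}) = len (adjoin Z x)"
      using B(1,5) xB len_adjoin[OF _ xc] 2 by simp
    moreover have "finite (B \<union> {x})" using B(1) by simp
    ultimately show ?case using li BZ by (intro exI[of _ "B \<union> {x}"] conjI)
  qed
  then obtain B where B: "finite B" "B \<subseteq> soc C" "V.lin_indpt B" "V.span B = soc C" "card B = len (soc C)" by blast
  have "V.basis B" using B V by (simp add: V.basis_def)
  from V.dim_basis[OF B(1) this] show ?thesis using B(5) by (simp add: module_type_def V_def)
qed

end

section \<open>The Frobenius case and the equivalence\<close>

context local_artinian_ring
begin

definition socle_generator :: "'a \<Rightarrow> bool" where
  "socle_generator s \<longleftrightarrow> s \<in> carrier R \<and> s \<noteq> \<zero> \<and> (\<forall>a\<in>\<mm>. a \<otimes> s = \<zero>) \<and>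
    (\<forall>y\<in>carrier R. (\<forall>a\<in>\<mm>. a \<otimes> y = \<zero>) \<longrightarrow> (\<exists>r\<in>carrier R. y = r \<otimes> s))"

text \<open>The annihilator of \<open>s\<close> is \<open>\<mm>\<close>, since everything outside \<open>\<mm>\<close> is a unit. So \<open>r s\<close> determines
  the coset of \<open>r\<close> and conversely.\<close>

lemma generator_coeff_eq_iff:
  assumes s: "socle_generator s" and r: "r \<in> carrier R" and t: "t \<in> carrier R"
  shows "r \<otimes> s = t \<otimes> s \<longleftrightarrow> \<mm> +>\<^bsub>R\<^esub> r = \<mm> +>\<^bsub>R\<^esub> t"
proof
  have sc: "s \<in> carrier R" "s \<noteq> \<zero>" using s unfolding socle_generator_def by auto
  assume eq: "r \<otimes> s = t \<otimes> s"
  have "(r \<ominus> t) \<otimes> s = r \<otimes> s \<ominus> t \<otimes> s" using r t sc(1) by (simp add: minus_eq l_distr l_minus)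
  also have "\<dots> = \<zero>" unfolding eq using t sc(1) by (simp add: minus_eq r_neg)
  finally have z: "(r \<ominus> t) \<otimes> s = \<zero>" .
  have "r \<ominus> t \<in> \<mm>"
  proof (rule ccontr)
    assume "r \<ominus> t \<notin> \<mm>"
    from unit_outside_max[OF minus_closed[OF r t] this] obtain u
      where u: "u \<in> carrier R" "u \<otimes> (r \<ominus> t) = \<one>" by blast
    have "s = (u \<otimes> (r \<ominus> t)) \<otimes> s" using sc(1) u(2) by simp
    also have "\<dots> = u \<otimes> ((r \<ominus> t) \<otimes> s)" using u(1) r t sc(1) by (intro m_assoc) auto
    also have "\<dots> = \<zero>" unfolding z using u(1) by simp
    finally show False using sc(2) by simp
  qed
  then have "(r \<ominus> t) \<oplus> t \<in> \<mm> +>\<^bsub>R\<^esub> t" unfolding a_r_coset_def' by blast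
  also have "(r \<ominus> t) \<oplus> t = r" using r t by (simp add: minus_eq a_assoc l_neg)
  finally have "\<mm> +>\<^bsub>R\<^esub> t = \<mm> +>\<^bsub>R\<^esub> r" using t by (rule maxi.a_repr_independence')
  then show "\<mm> +>\<^bsub>R\<^esub> r = \<mm> +>\<^bsub>R\<^esub> t" ..
next
  have sc: "s \<in> carrier R" "\<forall>a\<in>\<mm>. a \<otimes> s = \<zero>" using s unfolding socle_generator_def by auto
  assume "\<mm> +>\<^bsub>R\<^esub> r = \<mm> +>\<^bsub>R\<^esub> t"
  then have "r \<in> \<mm> +>\<^bsub>R\<^esub> t" using maxi.a_rcos_self[OF r] by simp
  then obtain h where h: "h \<in> \<mm>" "r = h \<oplus> t" unfolding a_r_coset_def' by blast
  have "r \<otimes> s = h \<otimes> s \<oplus> t \<otimes> s" unfolding h(2) using h(1) t sc(1) max_carr by (intro l_distr) auto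
  then show "r \<otimes> s = t \<otimes> s" using h(1) sc t by simp
qed

lemma residue_module_simps:
  "carrier (residue_module R \<mm>) = carrier (R Quot \<mm>)"
  "X \<oplus>\<^bsub>residue_module R \<mm>\<^esub> Y = X \<oplus>\<^bsub>R Quot \<mm>\<^esub> Y"
  "r \<odot>\<^bsub>residue_module R \<mm>\<^esub> X = (\<mm> +>\<^bsub>R\<^esub> r) \<otimes>\<^bsub>R Quot \<mm>\<^esub> X"
  by (simp_all add: residue_module_def)

text \<open>An isomorphism from the socle to the residue field and a generator of the socle determine each
  other: the generator corresponds to the coset of \<open>1\<close>, and the isomorphism sends \<open>r s\<close> to the
  coset of \<open>r\<close>.\<close>

lemma frobenius_iff_socle_generator:
  "frobenius_ring R \<mm> \<longleftrightarrow> (\<exists>s. socle_generator s)"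
proof
  define S where "S = {v \<in> carrier R. \<forall>a\<in>\<mm>. a \<otimes> v = \<zero>}"
  have sm: "socle \<mm> (regular_module R) = S" by (simp add: S_def socle_def regular_module_def)
  have qc: "carrier (R Quot \<mm>) = (\<lambda>r. \<mm> +>\<^bsub>R\<^esub> r) ` carrier R"
    unfolding FactRing_def A_RCOSETS_def' by auto
  note qm = ring_hom_mult[OF maxi.rcos_ring_hom, symmetric]
  note qa = ring_hom_add[OF maxi.rcos_ring_hom, symmetric]
  {
    assume "frobenius_ring R \<mm>"
    then obtain f where f: "f \<in> module_hom R ((regular_module R)\<lparr>carrier := S\<rparr>) (residue_module R \<mm>)"
      and bij: "bij_betw f S (carrier (R Quot \<mm>))"
      unfolding frobenius_ring_def module_iso_def sm by (auto simp: residue_module_simps)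
    have f_smult: "f (r \<otimes> v) = (\<mm> +>\<^bsub>R\<^esub> r) \<otimes>\<^bsub>R Quot \<mm>\<^esub> f v" if "r \<in> carrier R" "v \<in> S" for r v
      using module_hom_smult[OF f that(1), of v] that(2)
      by (simp add: residue_module_simps regular_module_def)
    have "\<mm> +>\<^bsub>R\<^esub> \<one> \<in> f ` S" using bij qc unfolding bij_betw_def by auto
    then obtain s where s: "s \<in> S" "f s = \<mm> +>\<^bsub>R\<^esub> \<one>" by auto
    have sc: "s \<in> carrier R" using s(1) by (simp add: S_def)
    have f_mult: "f (r \<otimes> s) = \<mm> +>\<^bsub>R\<^esub> r" if "r \<in> carrier R" for r
      using f_smult[OF that s(1)] that s(2) by (simp add: qm)
    have "s \<noteq> \<zero>"
    proof
      assume s0: "s = \<zero>"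
      have "\<zero> \<otimes> s = \<one> \<otimes> s" using s0 by simp
      then have "\<mm> +>\<^bsub>R\<^esub> \<one> = \<mm> +>\<^bsub>R\<^esub> \<zero>" using f_mult[of \<zero>] f_mult[of \<one>] by simp
      then have "\<one> \<in> \<mm> +>\<^bsub>R\<^esub> \<zero>" using maxi.a_rcos_self[OF one_closed] by simp
      then obtain h where "h \<in> \<mm>" "\<one> = h \<oplus> \<zero>" unfolding a_r_coset_def' by blast
      then have "\<one> = h" "h \<in> \<mm>" using max_carr by simp_all
      then show False using one_notin_max by blast
    qed
    moreover have "\<exists>r\<in>carrier R. y = r \<otimes> s" if y: "y \<in> S" for y
    proof -
      have "f y \<in> carrier (R Quot \<mm>)" using bij y unfolding bij_betw_def by blast
      then obtain r where r: "r \<in> carrier R" "f y = \<mm> +>\<^bsub>R\<^esub> r" unfolding qc by blast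
      have "r \<otimes> s \<in> S" using r(1) s(1) max_carr by (auto simp: S_def m_lcomm[of _ r s])
      moreover have "f y = f (r \<otimes> s)" using f_mult[OF r(1)] r(2) by simp
      ultimately have "y = r \<otimes> s" using bij y unfolding bij_betw_def inj_on_def by blast
      then show ?thesis using r(1) by blast
    qed
    ultimately have "socle_generator s" using s(1) unfolding socle_generator_def S_def by blast
    then show "\<exists>s. socle_generator s" ..
  next
    assume "\<exists>s. socle_generator s"
    then obtain s where s: "socle_generator s" ..
    have sc: "s \<in> carrier R" and ann: "\<forall>a\<in>\<mm>. a \<otimes> s = \<zero>" using s unfolding socle_generator_def by auto
    have rsS: "r \<otimes> s \<in> S" if "r \<in> carrier R" for r
      using that sc ann max_carr by (auto simp: S_def m_lcomm[of _ r s])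
    have S_ex: "\<exists>r\<in>carrier R. y = r \<otimes> s" if "y \<in> S" for y
      using that s unfolding socle_generator_def S_def by blast
    define f where "f y = \<mm> +>\<^bsub>R\<^esub> (SOME r. r \<in> carrier R \<and> y = r \<otimes> s)" for y
    have f: "f (r \<otimes> s) = \<mm> +>\<^bsub>R\<^esub> r" if r: "r \<in> carrier R" for r
    proof -
      let ?t = "SOME t. t \<in> carrier R \<and> r \<otimes> s = t \<otimes> s"
      have t: "?t \<in> carrier R \<and> r \<otimes> s = ?t \<otimes> s"
        by (rule someI[of "\<lambda>t. t \<in> carrier R \<and> r \<otimes> s = t \<otimes> s" r]) (simp add: r)
      have "\<mm> +>\<^bsub>R\<^esub> r = \<mm> +>\<^bsub>R\<^esub> ?t"
        by (rule iffD1[OF generator_coeff_eq_iff[OF s r conjunct1[OF t]] conjunct2[OF t]])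
      then show ?thesis unfolding f_def by (rule sym)
    qed
    have "bij_betw f S (carrier (R Quot \<mm>))" unfolding bij_betw_def
    proof
      show "inj_on f S"
      proof (rule inj_onI)
        fix x y assume "x \<in> S" "y \<in> S" "f x = f y"
        moreover obtain r where "r \<in> carrier R" "x = r \<otimes> s" using S_ex[OF \<open>x \<in> S\<close>] by blast
        moreover obtain t where "t \<in> carrier R" "y = t \<otimes> s" using S_ex[OF \<open>y \<in> S\<close>] by blast
        ultimately show "x = y" using generator_coeff_eq_iff[OF s] f by simp
      qed
      show "f ` S = carrier (R Quot \<mm>)"
      proof (rule antisym)
        show "f ` S \<subseteq> carrier (R Quot \<mm>)" unfolding qc
        proof (rule image_subsetI)
          fix y assume "y \<in> S"
          then obtain r where "r \<in> carrier R" "y = r \<otimes> s" using S_ex by blast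
          then show "f y \<in> (\<lambda>r. \<mm> +>\<^bsub>R\<^esub> r) ` carrier R" using f by simp
        qed
        show "carrier (R Quot \<mm>) \<subseteq> f ` S" unfolding qc
        proof (rule image_subsetI)
          fix r assume r: "r \<in> carrier R"
          show "\<mm> +>\<^bsub>R\<^esub> r \<in> f ` S" unfolding f[OF r, symmetric] by (rule imageI[OF rsS[OF r]])
        qed
      qed
    qed
    moreover have "f \<in> module_hom R ((regular_module R)\<lparr>carrier := S\<rparr>) (residue_module R \<mm>)"
    proof -
      have "f x \<in> carrier (R Quot \<mm>)" if "x \<in> S" for x
        using calculation that unfolding bij_betw_def by blast
      moreover have "f (x \<oplus> y) = f x \<oplus>\<^bsub>R Quot \<mm>\<^esub> f y" if xy: "x \<in> S" "y \<in> S" for x y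
      proof -
        obtain r t where rt: "r \<in> carrier R" "x = r \<otimes> s" "t \<in> carrier R" "y = t \<otimes> s"
          using S_ex xy by metis
        have "x \<oplus> y = (r \<oplus> t) \<otimes> s" using rt sc by (simp add: l_distr)
        then show ?thesis using rt f by (simp add: qa)
      qed
      moreover have "f (r \<otimes> x) = (\<mm> +>\<^bsub>R\<^esub> r) \<otimes>\<^bsub>R Quot \<mm>\<^esub> f x" if rx: "r \<in> carrier R" "x \<in> S" for r x
      proof -
        obtain t where t: "t \<in> carrier R" "x = t \<otimes> s" using S_ex rx by blast
        have "r \<otimes> x = (r \<otimes> t) \<otimes> s" using rx t sc by (simp add: m_assoc)
        then show ?thesis using rx(1) t f by (simp add: qm)
      qed
      ultimately show ?thesis by (simp add: module_hom_def residue_module_simps regular_module_def)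
    qed
    ultimately show "frobenius_ring R \<mm>"
      unfolding frobenius_ring_def module_iso_def sm
      by (intro bexI[of _ f]) (simp_all add: residue_module_simps)
  }
qed

end

context ambient_space
begin

abbreviation perp where "perp C \<equiv> orthogonal R n C"

lemma dot_add_right:
  "\<lbrakk>u \<in> carrier T; v \<in> carrier T; w \<in> carrier T\<rbrakk> \<Longrightarrow> dot n w (u \<oplus>\<^bsub>T\<^esub> v) = dot n w u \<oplus> dot n w v"
  by (simp add: dot_comm[of w] dot_add_left)

lemma dot_smult_right:
  "\<lbrakk>r \<in> carrier R; v \<in> carrier T; w \<in> carrier T\<rbrakk> \<Longrightarrow> dot n w (r \<odot>\<^bsub>T\<^esub> v) = r \<otimes> dot n w v"
  by (simp add: dot_comm[of w] dot_smult_left)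

text \<open>For \<open>y\<close> orthogonal to \<open>Z\<close>, the product \<open>y \<cdot> x\<close> is annihilated by \<open>\<mm>\<close> because
  \<open>\<mm> x \<subseteq> Z\<close>; so it is a multiple of \<open>s\<close>. The orthogonal of \<open>Z + R x\<close> is the kernel of
  \<open>y \<mapsto> y \<cdot> x\<close>, a map into the simple module \<open>R s\<close>.\<close>

lemma orthogonal_step:
  assumes s: "socle_generator s" and Z: "submodule R Z T" and x: "x \<in> carrier T"
    and m: "\<forall>a\<in>\<mm>. a \<odot>\<^bsub>T\<^esub> x \<in> Z"
  shows "module_step (perp (adjoin Z x)) (perp Z)"
proof -
  note zc = sub_carrier[OF Z]
  have perp_carr: "y \<in> carrier T" if "y \<in> perp Z" for y using that by (simp add: orthogonal_alt)
  have sc: "s \<in> carrier R" using s unfolding socle_generator_def by blast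
  have perp_iff: "y \<in> perp (adjoin Z x)" if y: "y \<in> perp Z" and 0: "dot n y x = \<zero>" for y
  proof -
    have "dot n y w = \<zero>" if w: "w \<in> adjoin Z x" for w
    proof -
      obtain k r where k: "k \<in> Z" "r \<in> carrier R" "w = k \<oplus>\<^bsub>T\<^esub> r \<odot>\<^bsub>T\<^esub> x" using w by (rule adjoinE)
      have "dot n y k = \<zero>" using y k(1) by (simp add: orthogonal_alt)
      then show ?thesis unfolding k(3) using k(2) zc[OF k(1)] x perp_carr[OF y] 0
        by (simp add: dot_add_right dot_smult_right)
    qed
    then show ?thesis using perp_carr[OF y] by (simp add: orthogonal_alt)
  qed
  have coeff: "\<exists>r\<in>carrier R. dot n y x = r \<otimes> s" if y: "y \<in> perp Z" for y
  proof -
    have yc: "y \<in> carrier T" using y by (rule perp_carr)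
    have "a \<otimes> dot n y x = \<zero>" if "a \<in> \<mm>" for a
    proof -
      have "a \<otimes> dot n y x = dot n y (a \<odot>\<^bsub>T\<^esub> x)" using max_carr[OF that] yc x by (simp add: dot_smult_right)
      also have "\<dots> = \<zero>" using y m that by (simp add: orthogonal_alt)
      finally show ?thesis .
    qed
    then show ?thesis using s dot_closed[OF yc x] unfolding socle_generator_def by blast
  qed
  show ?thesis unfolding module_step_def
  proof (intro conjI ballI)
    show "perp (adjoin Z x) \<subseteq> perp Z" by (rule orthogonal_antimono[OF adjoin_superset[OF Z x]])
    fix c d assume c: "c \<in> perp Z - perp (adjoin Z x)" and d: "d \<in> perp Z"
    have cc: "c \<in> carrier T" "d \<in> carrier T" using c d perp_carr by auto
    obtain r where r: "r \<in> carrier R" "dot n c x = r \<otimes> s" using coeff c by blast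
    obtain t where t: "t \<in> carrier R" "dot n d x = t \<otimes> s" using coeff d by blast
    have "dot n c x \<noteq> \<zero>" using c perp_iff by blast
    then have "r \<notin> \<mm>" using r s unfolding socle_generator_def by auto
    from unit_outside_max[OF r(1) this] obtain u where u: "u \<in> carrier R" "u \<otimes> r = \<one>" by blast
    let ?q = "t \<otimes> u" and ?k = "d \<ominus>\<^bsub>T\<^esub> (t \<otimes> u) \<odot>\<^bsub>T\<^esub> c"
    have q: "?q \<in> carrier R" using t u by simp
    have qs: "?q \<otimes> (r \<otimes> s) = t \<otimes> s"
    proof -
      have "?q \<otimes> (r \<otimes> s) = t \<otimes> ((u \<otimes> r) \<otimes> s)" using t(1) u(1) r(1) sc by (simp add: R.m_assoc)
      then show ?thesis using u(2) sc by simp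
    qed
    have kP: "?k \<in> perp Z" using c d q
      by (intro sub_minus[OF orthogonal_submodule[OF Z]] sub_smult[OF orthogonal_submodule[OF Z]]) auto
    have kc: "?k \<in> carrier T" using kP by (rule perp_carr)
    have e: "d = ?k \<oplus>\<^bsub>T\<^esub> ?q \<odot>\<^bsub>T\<^esub> c" using cc q by (simp add: minus_add_cancel)
    have "dot n d x = dot n (?k \<oplus>\<^bsub>T\<^esub> ?q \<odot>\<^bsub>T\<^esub> c) x" by (rule arg_cong[OF e])
    also have "\<dots> = dot n ?k x \<oplus> ?q \<otimes> dot n c x"
      using kc cc q x by (simp only: dot_add_left dot_smult_left smult_closed)
    finally have "t \<otimes> s = dot n ?k x \<oplus> t \<otimes> s" unfolding r(2) t(2) qs .
    then have "dot n ?k x = \<zero>" using dot_closed[OF kc x] t(1) sc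
      by (metis R.add.r_cancel_one' R.m_closed)
    then have "?k \<in> perp (adjoin Z x)" by (rule perp_iff[OF kP])
    then show "\<exists>k\<in>perp (adjoin Z x). \<exists>q\<in>carrier R. d = k \<oplus>\<^bsub>T\<^esub> q \<odot>\<^bsub>T\<^esub> c" using e q by blast
  qed
qed

text \<open>Along a chain of simple steps the length of a submodule rises by exactly one at each step and that
  of its orthogonal falls by at most one, so their sum is monotone. It agrees at the two ends \<open>0\<close> and
  \<open>R^n\<close>, hence it is constant.\<close>

lemma len_orthogonal:
  assumes s: "socle_generator s" and C: "submodule R C T"
  shows "len C + len (perp C) = len (carrier T)"
proof -
  have mono: "len X + len (perp X) \<le> len Y + len (perp Y)"
    if X: "submodule R X T" and Y: "submodule R Y T" and XY: "X \<subseteq> Y" for X Y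
  proof (induction rule: submodule_chain_induct[OF X Y XY])
    case 1
    show ?case by simp
  next
    case (2 Z x)
    have xc: "x \<in> carrier T" using 2 sub_carrier[OF Y] by blast
    have "len (adjoin Z x) = len Z + 1" using 2 xc by (intro len_adjoin) auto
    moreover have "len (perp Z) \<le> len (perp (adjoin Z x)) + 1"
      using 2 xc
      by (intro len_step orthogonal_step[OF s] orthogonal_submodule adjoin_submodule) auto
    ultimately show ?case using 2 by linarith
  qed
  have z: "submodule R {\<zero>\<^bsub>T\<^esub>} T" by (rule submodI) auto
  have t: "submodule R (carrier T) T" by (rule carrier_sub[OF tuples_module])
  have "len (carrier T) \<le> len C + len (perp C)"
    using mono[OF z C] sub_zero[OF C] by (simp add: orthogonal_zero len_zero)
  moreover have "len C + len (perp C) \<le> len (carrier T)"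
    using mono[OF C t] sub_carrier[OF C] by (simp add: orthogonal_carrier len_zero subsetI)
  ultimately show ?thesis by simp
qed

lemma double_orthogonal:
  assumes s: "socle_generator s" and C: "submodule R C T"
  shows "perp (perp C) = C"
proof -
  have P: "submodule R (perp C) T" by (rule orthogonal_submodule[OF C])
  have "C = perp (perp C)"
    using len_orthogonal[OF s C] len_orthogonal[OF s P]
    by (intro eq_if_len_le[OF C orthogonal_submodule[OF P] orthogonal_orthogonal[OF C]]) simp
  then show ?thesis ..
qed

lemma orthogonal_scaled:
  assumes s: "s \<in> carrier R" and X: "submodule R X T"
  shows "perp (scaled s X) = {v \<in> carrier T. s \<odot>\<^bsub>T\<^esub> v \<in> perp X}"
proof -
  note c = sub_carrier[OF X]
  have "dot n v (s \<odot>\<^bsub>T\<^esub> w) = dot n (s \<odot>\<^bsub>T\<^esub> v) w" if "v \<in> carrier T" "w \<in> X" for v w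
    using that s c by (simp add: dot_smult_left dot_smult_right)
  then show ?thesis using s by (auto simp: orthogonal_alt scaled_def)
qed

text \<open>Rank and nullity for multiplication by \<open>s\<close>, restricted to submodules \<open>W\<close> that contain the whole
  kernel. Each simple step from the kernel up to \<open>W\<close> maps to a simple step between the images, and
  no step collapses because the kernel is contained in the smaller submodule.\<close>

lemma len_scaled_kernel:
  assumes s: "s \<in> carrier R" and W: "submodule R W T"
    and ker: "{v \<in> carrier T. s \<odot>\<^bsub>T\<^esub> v = \<zero>\<^bsub>T\<^esub>} \<subseteq> W"
  shows "len (scaled s W) + len {v \<in> carrier T. s \<odot>\<^bsub>T\<^esub> v = \<zero>\<^bsub>T\<^esub>} = len W"
proof -
  let ?K = "{v \<in> carrier T. s \<odot>\<^bsub>T\<^esub> v = \<zero>\<^bsub>T\<^esub>}"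
  have K: "submodule R ?K T"
    by (rule submodI) (use s in \<open>auto simp: smult_r_distr smult_swap[of s]\<close>)
  show ?thesis
  proof (induction rule: submodule_chain_induct[OF K W ker])
    case 1
    have "scaled s ?K \<subseteq> {\<zero>\<^bsub>T\<^esub>}" by (auto simp: scaled_def)
    from len_mono[OF this] show ?case by (simp add: len_zero)
  next
    case (2 Z x)
    note Z = 2(1)
    note zc = sub_carrier[OF Z]
    have xc: "x \<in> carrier T" using 2 sub_carrier[OF W] by blast
    have sZ: "submodule R (scaled s Z) T" by (rule scaled_submodule[OF Z s])
    have "scaled s (adjoin Z x) = adjoin (scaled s Z) (s \<odot>\<^bsub>T\<^esub> x)"
    proof -
      have "s \<odot>\<^bsub>T\<^esub> (k \<oplus>\<^bsub>T\<^esub> r \<odot>\<^bsub>T\<^esub> x) = s \<odot>\<^bsub>T\<^esub> k \<oplus>\<^bsub>T\<^esub> r \<odot>\<^bsub>T\<^esub> (s \<odot>\<^bsub>T\<^esub> x)"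
        if "k \<in> Z" "r \<in> carrier R" for k r
        using that s zc xc by (simp add: smult_r_distr smult_swap[of s r])
      note e = this
      show ?thesis
      proof (rule antisym)
        show "scaled s (adjoin Z x) \<subseteq> adjoin (scaled s Z) (s \<odot>\<^bsub>T\<^esub> x)"
          unfolding scaled_def using e by (auto elim!: adjoinE intro!: adjoinI)
        show "adjoin (scaled s Z) (s \<odot>\<^bsub>T\<^esub> x) \<subseteq> scaled s (adjoin Z x)"
        proof
          fix z assume "z \<in> adjoin (scaled s Z) (s \<odot>\<^bsub>T\<^esub> x)"
          then obtain k r where "k \<in> Z" "r \<in> carrier R" "z = s \<odot>\<^bsub>T\<^esub> k \<oplus>\<^bsub>T\<^esub> r \<odot>\<^bsub>T\<^esub> (s \<odot>\<^bsub>T\<^esub> x)"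
            unfolding scaled_def by (auto elim!: adjoinE)
          then have "z = s \<odot>\<^bsub>T\<^esub> (k \<oplus>\<^bsub>T\<^esub> r \<odot>\<^bsub>T\<^esub> x)" "k \<oplus>\<^bsub>T\<^esub> r \<odot>\<^bsub>T\<^esub> x \<in> adjoin Z x"
            using e adjoinI by simp_all
          then show "z \<in> scaled s (adjoin Z x)" unfolding scaled_def by (rule image_eqI)
        qed
      qed
    qed
    moreover have "s \<odot>\<^bsub>T\<^esub> x \<notin> scaled s Z"
    proof
      assume "s \<odot>\<^bsub>T\<^esub> x \<in> scaled s Z"
      then obtain z where z: "z \<in> Z" "s \<odot>\<^bsub>T\<^esub> x = s \<odot>\<^bsub>T\<^esub> z" unfolding scaled_def by blast
      have "s \<odot>\<^bsub>T\<^esub> (x \<ominus>\<^bsub>T\<^esub> z) = s \<odot>\<^bsub>T\<^esub> x \<ominus>\<^bsub>T\<^esub> s \<odot>\<^bsub>T\<^esub> z"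
        using s xc zc[OF z(1)] by (simp add: M.minus_eq smult_r_distr smult_r_minus)
      also have "\<dots> = \<zero>\<^bsub>T\<^esub>" unfolding z(2) using s zc[OF z(1)] by (simp add: M.minus_eq M.r_neg)
      finally have "x \<ominus>\<^bsub>T\<^esub> z \<in> Z" using 2(2) xc zc[OF z(1)] by auto
      from sub_add[OF Z this z(1)] have "x \<in> Z" using minus_add_cancel[OF xc zc[OF z(1)]] by simp
      then show False using 2 by blast
    qed
    moreover have "\<forall>a\<in>\<mm>. a \<odot>\<^bsub>T\<^esub> (s \<odot>\<^bsub>T\<^esub> x) \<in> scaled s Z"
      using 2 s xc max_carr by (auto simp: scaled_def smult_swap[of _ s])
    ultimately have "len (scaled s (adjoin Z x)) = len (scaled s Z) + 1"
      using len_adjoin[OF sZ] s xc by simp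
    moreover have "len (adjoin Z x) = len Z + 1" using 2 xc by (intro len_adjoin) auto
    ultimately show ?case using 2 by simp
  qed
qed

lemma len_scaled_carrier:
  assumes "s \<in> carrier R" "s \<noteq> \<zero>" "\<forall>a\<in>\<mm>. a \<otimes> s = \<zero>"
  shows "len (scaled s (carrier T)) = n"
  using len_scaled_free[OF assms, of "\<lambda>v. v" n] by (simp add: module_hom_def)

text \<open>The coordinates of a socle element are annihilated by \<open>\<mm>\<close>, so all of them are multiples of \<open>s\<close>.\<close>

lemma soc_eq_scaled:
  assumes s: "socle_generator s" and C: "submodule R C T"
  shows "soc C = scaled s {v \<in> carrier T. s \<odot>\<^bsub>T\<^esub> v \<in> C}"
proof
  have sc: "s \<in> carrier R" "\<forall>a\<in>\<mm>. a \<otimes> s = \<zero>" using s unfolding socle_generator_def by auto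
  show "scaled s {v \<in> carrier T. s \<odot>\<^bsub>T\<^esub> v \<in> C} \<subseteq> soc C"
  proof
    fix y assume "y \<in> scaled s {v \<in> carrier T. s \<odot>\<^bsub>T\<^esub> v \<in> C}"
    then obtain v where v: "v \<in> carrier T" "y \<in> C" "y = s \<odot>\<^bsub>T\<^esub> v" unfolding scaled_def by blast
    have "a \<odot>\<^bsub>T\<^esub> y = \<zero>\<^bsub>T\<^esub>" if a: "a \<in> \<mm>" for a
    proof -
      have "a \<odot>\<^bsub>T\<^esub> y = (a \<otimes> s) \<odot>\<^bsub>T\<^esub> v" unfolding v(3) using max_carr[OF a] sc(1) v(1) by (simp add: smult_assoc1)
      then show ?thesis using sc(2) a v(1) by simp
    qed
    then show "y \<in> soc C" using v(2) by (simp add: soc_iff)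
  qed
  show "soc C \<subseteq> scaled s {v \<in> carrier T. s \<odot>\<^bsub>T\<^esub> v \<in> C}"
  proof
    fix y assume y: "y \<in> soc C"
    have yc: "y \<in> carrier T" using y sub_carrier[OF C] by (simp add: soc_iff)
    have "\<exists>r\<in>carrier R. y i = r \<otimes> s" if i: "i < n" for i
    proof -
      have "a \<otimes> y i = \<zero>" if a: "a \<in> \<mm>" for a
      proof -
        have "a \<otimes> y i = (a \<odot>\<^bsub>T\<^esub> y) i" using i by (simp add: tuples_smult_nth)
        also have "\<dots> = \<zero>\<^bsub>T\<^esub> i" using y a by (simp add: soc_iff)
        finally show ?thesis using i by (simp add: tuples_zero_nth)
      qed
      then show ?thesis using s tuples_nth_closed[OF yc i] unfolding socle_generator_def by blast
    qed
    then obtain r where r: "\<And>i. i < n \<Longrightarrow> r i \<in> carrier R \<and> y i = r i \<otimes> s" by metis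
    define v where "v = restrict r {..<n}"
    have v: "v \<in> carrier T" unfolding v_def by (rule tuples_restrictI) (simp add: r)
    have "y = s \<odot>\<^bsub>T\<^esub> v"
    proof (rule tuples_eqI[OF yc])
      show "s \<odot>\<^bsub>T\<^esub> v \<in> carrier T" using sc(1) v by simp
      show "y i = (s \<odot>\<^bsub>T\<^esub> v) i" if "i < n" for i
        using r[OF that] that sc(1) by (simp add: tuples_smult_nth v_def R.m_comm)
    qed
    moreover have "y \<in> C" using y by (simp add: soc_iff)
    ultimately show "y \<in> scaled s {v \<in> carrier T. s \<odot>\<^bsub>T\<^esub> v \<in> C}" using v unfolding scaled_def by blast
  qed
qed

text \<open>With \<open>D\<close> the orthogonal of \<open>C\<close>, both \<open>W = {v. s v \<in> C}\<close> and the kernel \<open>K\<close> of \<open>s\<close> are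
  orthogonals, namely of \<open>s D\<close> and of \<open>s R^n\<close>; for \<open>W\<close> this uses that \<open>C\<close> is the orthogonal of
  \<open>D\<close>. Their lengths are thus \<open>N - len (s D)\<close> and \<open>N - n\<close> with \<open>N\<close> the length of \<open>R^n\<close>, and the
  socle \<open>s W\<close> of \<open>C\<close> has length \<open>len W - len K\<close>.\<close>

lemma type_plus_free_rank:
  assumes s: "socle_generator s" and C: "submodule R C T"
  shows "module_type R \<mm> (T\<lparr>carrier := C\<rparr>) + free_rank R (T\<lparr>carrier := perp C\<rparr>) = n"
proof -
  have sc: "s \<in> carrier R" "s \<noteq> \<zero>" "\<forall>a\<in>\<mm>. a \<otimes> s = \<zero>"
    using s unfolding socle_generator_def by auto
  let ?K = "{v \<in> carrier T. s \<odot>\<^bsub>T\<^esub> v = \<zero>\<^bsub>T\<^esub>}" and ?W = "{v \<in> carrier T. s \<odot>\<^bsub>T\<^esub> v \<in> C}"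
  have P: "submodule R (perp C) T" by (rule orthogonal_submodule[OF C])
  have sP: "submodule R (scaled s (perp C)) T" by (rule scaled_submodule[OF P sc(1)])
  have t: "submodule R (carrier T) T" by (rule carrier_sub[OF tuples_module])
  have W: "perp (scaled s (perp C)) = ?W"
    using orthogonal_scaled[OF sc(1) P] by (simp add: double_orthogonal[OF s C])
  have K: "perp (scaled s (carrier T)) = ?K"
    using orthogonal_scaled[OF sc(1) t] by (simp add: orthogonal_carrier)
  have "len (scaled s (perp C)) + len ?W = len (carrier T)"
    using len_orthogonal[OF s sP] by (simp add: W)
  moreover have "n + len ?K = len (carrier T)"
    using len_orthogonal[OF s scaled_submodule[OF t sc(1)]] by (simp add: K len_scaled_carrier[OF sc])
  moreover have "len (soc C) + len ?K = len ?W"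
    unfolding soc_eq_scaled[OF s C]
  proof (rule len_scaled_kernel[OF sc(1)])
    show "submodule R ?W T" unfolding W[symmetric] by (rule orthogonal_submodule[OF sP])
    show "?K \<subseteq> ?W" using sub_zero[OF C] by auto
  qed
  ultimately show ?thesis
    by (simp add: module_type_eq_len[OF C] free_rank_eq_len[OF sc P])
qed

text \<open>The orthogonal of \<open>R\<close> is zero and has free rank zero, so the socle of \<open>R\<close> has length one and is
  generated by any of its nonzero elements \<open>x\<close>.\<close>

lemma socle_generator_if_type_plus_free_rank:
  assumes n: "n = 1"
    and eq: "module_type R \<mm> (T\<lparr>carrier := carrier T\<rparr>) + free_rank R (T\<lparr>carrier := perp (carrier T)\<rparr>) = n"
  shows "\<exists>s. socle_generator s"
proof -
  have t: "submodule R (carrier T) T" by (rule carrier_sub[OF tuples_module])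
  have z: "submodule R {\<zero>\<^bsub>T\<^esub>} T" by (rule submodI) auto
  have "tuple_at n 0 \<one> \<noteq> \<zero>\<^bsub>T\<^esub>"
  proof
    assume "tuple_at n 0 \<one> = \<zero>\<^bsub>T\<^esub>"
    then have "tuple_at n 0 \<one> 0 = \<zero>\<^bsub>T\<^esub> 0" by simp
    then have "\<one> = \<zero>" using n by (simp add: tuple_at_nth tuples_zero_nth)
    then show False using one_notin_max maxi.zero_closed by simp
  qed
  then have "{\<zero>\<^bsub>T\<^esub>} \<subset> carrier T" using tuple_at_carrier[OF R.one_closed, of n 0] by auto
  from socle_of_quotient[OF z t this] obtain x
    where x: "x \<in> carrier T" "x \<noteq> \<zero>\<^bsub>T\<^esub>" "\<forall>a\<in>\<mm>. a \<odot>\<^bsub>T\<^esub> x = \<zero>\<^bsub>T\<^esub>" by auto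
  define s where "s = x 0"
  have sc: "s \<in> carrier R" unfolding s_def using x(1) n by (intro tuples_nth_closed) auto
  have snz: "s \<noteq> \<zero>"
  proof
    assume "s = \<zero>"
    then have "x = \<zero>\<^bsub>T\<^esub>" using n by (intro tuples_eqI[OF x(1) M.zero_closed]) (simp add: tuples_zero_nth s_def)
    then show False using x(2) by simp
  qed
  have ann: "\<forall>a\<in>\<mm>. a \<otimes> s = \<zero>"
  proof
    fix a assume a: "a \<in> \<mm>"
    have "a \<otimes> s = (a \<odot>\<^bsub>T\<^esub> x) 0" using n by (simp add: tuples_smult_nth s_def)
    also have "\<dots> = \<zero>" using x(3) a n by (simp add: tuples_zero_nth)
    finally show "a \<otimes> s = \<zero>" .
  qed
  have "scaled s {\<zero>\<^bsub>T\<^esub>} = {\<zero>\<^bsub>T\<^esub>}" using sc by (simp add: scaled_def)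
  then have "free_rank R (T\<lparr>carrier := perp (carrier T)\<rparr>) = 0"
    unfolding orthogonal_carrier free_rank_eq_len[OF sc snz ann z] by (simp add: len_zero)
  then have len1: "len (soc (carrier T)) = 1"
    using eq n unfolding module_type_eq_len[OF t] by linarith
  have S: "submodule R (soc (carrier T)) T" by (rule soc_submodule[OF t])
  have "x \<in> soc (carrier T)" using x unfolding soc_iff by blast
  moreover have "{\<zero>\<^bsub>T\<^esub>} \<subseteq> soc (carrier T)" using sub_zero[OF S] by simp
  ultimately have sub: "adjoin {\<zero>\<^bsub>T\<^esub>} x \<subseteq> soc (carrier T)" by (intro adjoin_least[OF S])
  have "len (adjoin {\<zero>\<^bsub>T\<^esub>} x) = 1" using len_adjoin[OF z x(1)] x(2,3) by (simp add: len_zero)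
  then have gen: "adjoin {\<zero>\<^bsub>T\<^esub>} x = soc (carrier T)"
    using len1 by (intro eq_if_len_le[OF adjoin_submodule[OF z x(1)] S sub]) simp
  have "\<exists>r\<in>carrier R. y = r \<otimes> s" if y: "y \<in> carrier R" "\<forall>a\<in>\<mm>. a \<otimes> y = \<zero>" for y
  proof -
    let ?y = "tuple_at n 0 y"
    have yc: "?y \<in> carrier T" using y(1) by (rule tuple_at_carrier)
    have "a \<odot>\<^bsub>T\<^esub> ?y = \<zero>\<^bsub>T\<^esub>" if a: "a \<in> \<mm>" for a
    proof (rule tuples_eqI[of _ n])
      show "a \<odot>\<^bsub>T\<^esub> ?y \<in> carrier T" using max_carr[OF a] yc by simp
      show "(a \<odot>\<^bsub>T\<^esub> ?y) i = \<zero>\<^bsub>T\<^esub> i" if "i < n" for i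
        using that a y(2) n by (simp add: tuples_smult_nth tuples_zero_nth tuple_at_nth)
    qed simp
    then have "?y \<in> soc (carrier T)" using yc unfolding soc_iff by blast
    then have "?y \<in> adjoin {\<zero>\<^bsub>T\<^esub>} x" unfolding gen .
    then obtain k r where kr: "k \<in> {\<zero>\<^bsub>T\<^esub>}" "r \<in> carrier R" "?y = k \<oplus>\<^bsub>T\<^esub> r \<odot>\<^bsub>T\<^esub> x" by (rule adjoinE)
    have "?y = r \<odot>\<^bsub>T\<^esub> x" using kr x(1) by simp
    then have "?y 0 = (r \<odot>\<^bsub>T\<^esub> x) 0" by simp
    then have "y = r \<otimes> s" using n by (simp add: tuple_at_nth tuples_smult_nth s_def)
    then show ?thesis using kr(2) by blast
  qed
  then have "socle_generator s" unfolding socle_generator_def using sc snz ann by blast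
  then show ?thesis ..
qed

end

theorem theorem1:
  fixes R :: "('a, 'r) ring_scheme" and \<mm> :: "'a set"
  assumes "local_artinian_ring R \<mm>"
  shows "frobenius_ring R \<mm> \<longleftrightarrow>
    (\<forall>n\<ge>1. \<forall>C. submodule R C (tuples R n) \<longrightarrow>
      module_type R \<mm> ((tuples R n)\<lparr>carrier := C\<rparr>)
        + free_rank R ((tuples R n)\<lparr>carrier := orthogonal R n C\<rparr>) = n)"
    (is "_ \<longleftrightarrow> ?formula")
proof
  interpret local_artinian_ring R \<mm> by (rule assms)
  show ?formula if "frobenius_ring R \<mm>"
  proof (intro allI impI)
    obtain s where s: "socle_generator s" using \<open>frobenius_ring R \<mm>\<close> frobenius_iff_socle_generator by blast
    fix n C assume C: "submodule R C (tuples R n)"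
    obtain A l where "finite_length_module R \<mm> (tuples R n) A l" using tuples_finite_length by blast
    then interpret ambient_space R \<mm> n A l by (rule ambient_space.intro)
    show "module_type R \<mm> ((tuples R n)\<lparr>carrier := C\<rparr>)
        + free_rank R ((tuples R n)\<lparr>carrier := orthogonal R n C\<rparr>) = n"
      by (rule type_plus_free_rank[OF s C])
  qed
  show "frobenius_ring R \<mm>" if ?formula
  proof -
    obtain A l where "finite_length_module R \<mm> (tuples R 1) A l" using tuples_finite_length by blast
    then interpret ambient_space R \<mm> 1 A l by (rule ambient_space.intro)
    have "\<exists>s. socle_generator s"
      using \<open>?formula\<close> carrier_sub[OF tuples_module]
      by (intro socle_generator_if_type_plus_free_rank refl) blast
    then show ?thesis by (simp add: frobenius_iff_socle_generator)
  qed
qed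

end
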